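(* Let $(M,g,\xi,\lambda)$ be an $n$-dimensional connected Yamabe soliton with $n>2$ and scalar curvature $R$. Suppose there is a constant $\mu>0$ such that the soliton field satisfies $Q(\xi)+\Delta\xi=\mu\,\xi$ and such that $$\lambda\le R\le \frac{n(n-1)}{n-2}\,\mu \quad\text{on } M.$$ Then $g$ is a Yamabe metric, i.e. $R$ is constant on $M$.
   Context: A Yamabe soliton $(M,g,\xi,\lambda)$ is a connected smooth Riemannian manifold $(M,g)$ together with a smooth vector field $\xi$ (the soliton field) and a constant $\lambda\in\mathbb{R}$ such that $\frac12\mathcal{L}_\xi g=(R-\lambda)g$, where $\mathcal{L}_\xi$ is the Lie derivative and $R$ is the scalar curvature of $g$. No compactness or completeness is assumed. The metric $g$ is called a Yamabe metric if $R$ is constant. $\mathrm{Ric}$ is the Ricci tensor, $\nabla$ the Levi-Civita connection, and the Ricci operator $Q$ is defined by $g(QX,Y)=\mathrm{Ric}(X,Y)$. The Laplace operator on smooth vector fields is $\Delta X=\sum_{i=1}^n\left(\nabla_{e_i}\nabla_{e_i}X-\nabla_{\nabla_{e_i}e_i}X\right)$ for a local orthonormal frame $\{e_1,\dots,e_n\}$. *)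

theory Defs
  imports "HOL-Analysis.Analysis"
begin

section \<open>Smooth maps between Euclidean spaces\<close>

definition partial :: "'n::finite \<Rightarrow> (real^'n \<Rightarrow> 'b::real_normed_vector) \<Rightarrow> real^'n \<Rightarrow> 'b" where
  "partial i f x = frechet_derivative f (at x) (axis i 1)"

(* Used for open sets S only. *)
primrec Ck_on :: "nat \<Rightarrow> (real^'n::finite) set \<Rightarrow> (real^'n \<Rightarrow> 'b::real_normed_vector) \<Rightarrow> bool" where
  "Ck_on 0 S f \<longleftrightarrow> continuous_on S f"
| "Ck_on (Suc k) S f \<longleftrightarrow> (\<forall>x\<in>S. f differentiable (at x)) \<and> (\<forall>i. Ck_on k S (partial i f))"

definition smooth_on :: "(real^'n::finite) set \<Rightarrow> (real^'n \<Rightarrow> 'b::real_normed_vector) \<Rightarrow> bool" where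
  "smooth_on S f \<longleftrightarrow> (\<forall>k. Ck_on k S f)"


section \<open>Smooth manifolds\<close>

(* A chart is a pair (U, phi) of its domain and its coordinate map; phi is irrelevant outside U. *)
type_synonym ('a, 'n) chart = "'a set \<times> ('a \<Rightarrow> real^'n)"

definition chart_image :: "('a, 'n::finite) chart \<Rightarrow> (real^'n) set" where
  "chart_image c = snd c ` fst c"

definition transition :: "('a, 'n::finite) chart \<Rightarrow> ('a, 'n) chart \<Rightarrow> real^'n \<Rightarrow> real^'n" where
  "transition c d = snd d \<circ> inv_into (fst c) (snd c)"

definition overlap :: "('a, 'n::finite) chart \<Rightarrow> ('a, 'n) chart \<Rightarrow> (real^'n) set" where
  "overlap c d = snd c ` (fst c \<inter> fst d)"

(* A is a smooth atlas, not assumed to be maximal. The dimension is CARD('n). *)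
locale smooth_manifold =
  fixes M :: "'a topology" and A :: "('a, 'n::finite) chart set"
  assumes Hausdorff: "Hausdorff_space M"
    and second_countable: "second_countable M"
    and chart_domain: "c \<in> A \<Longrightarrow> openin M (fst c)"
    and chart_image_open: "c \<in> A \<Longrightarrow> open (chart_image c)"
    and chart_homeomorphic:
      "c \<in> A \<Longrightarrow> homeomorphic_map (subtopology M (fst c)) (top_of_set (chart_image c)) (snd c)"
    and charts_cover: "(\<Union>c\<in>A. fst c) = topspace M"
    and transition_smooth:
      "c \<in> A \<Longrightarrow> d \<in> A \<Longrightarrow> smooth_on (overlap c d) (transition c d)"


section \<open>Vector fields and Riemannian metrics\<close>

(* A vector field is the family X of its local representatives: X c is a function on the image of
   the chart c, and the representatives are related by the Jacobians of the transition maps. *)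
definition smooth_vector_field ::
  "('a, 'n::finite) chart set \<Rightarrow> (('a, 'n) chart \<Rightarrow> real^'n \<Rightarrow> real^'n) \<Rightarrow> bool" where
  "smooth_vector_field A X \<longleftrightarrow>
     (\<forall>c\<in>A. smooth_on (chart_image c) (X c)) \<and>
     (\<forall>c\<in>A. \<forall>d\<in>A. \<forall>x\<in>overlap c d.
        X d (transition c d x) = frechet_derivative (transition c d) (at x) (X c x))"

(* The inner product at x for a metric with component matrix G in one chart. *)
definition metric_inner ::
  "(real^'n \<Rightarrow> real^'n^'n::finite) \<Rightarrow> real^'n \<Rightarrow> real^'n \<Rightarrow> real^'n \<Rightarrow> real" where
  "metric_inner G x v w = (\<Sum>i\<in>UNIV. \<Sum>j\<in>UNIV. G x $ i $ j * v $ i * w $ j)"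

(* Like a vector field, a metric g is the family of its component matrices in the charts. *)
locale riemannian_manifold = smooth_manifold M A
  for M :: "'a topology" and A :: "('a, 'n::finite) chart set" +
  fixes g :: "('a, 'n) chart \<Rightarrow> real^'n \<Rightarrow> real^'n^'n"
  assumes metric_smooth: "c \<in> A \<Longrightarrow> smooth_on (chart_image c) (g c)"
    and metric_symmetric:
      "c \<in> A \<Longrightarrow> x \<in> chart_image c \<Longrightarrow> metric_inner (g c) x v w = metric_inner (g c) x w v"
    and metric_positive:
      "c \<in> A \<Longrightarrow> x \<in> chart_image c \<Longrightarrow> v \<noteq> 0 \<Longrightarrow> metric_inner (g c) x v v > 0"
    and metric_transform:
      "c \<in> A \<Longrightarrow> d \<in> A \<Longrightarrow> x \<in> overlap c d \<Longrightarrow>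
        metric_inner (g c) x v w =
        metric_inner (g d) (transition c d x)
          (frechet_derivative (transition c d) (at x) v)
          (frechet_derivative (transition c d) (at x) w)"


section \<open>Local Riemannian geometry in a chart\<close>

definition lie_bracket ::
  "(real^'n \<Rightarrow> real^'n) \<Rightarrow> (real^'n \<Rightarrow> real^'n::finite) \<Rightarrow> real^'n \<Rightarrow> real^'n" where
  "lie_bracket X Y x = frechet_derivative Y (at x) (X x) - frechet_derivative X (at x) (Y x)"

(* (L_X g)(v,w) = X (g(v,w)) - g([X,v],w) - g(v,[X,w]), with v and w extended to the vector fields
   that are constant in the coordinates; by tensoriality the extension does not matter. *)
definition lie_derivative_metric ::
  "(real^'n \<Rightarrow> real^'n) \<Rightarrow> (real^'n \<Rightarrow> real^'n^'n::finite) \<Rightarrow> real^'n \<Rightarrow> real^'n \<Rightarrow> real^'n \<Rightarrow> real" where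
  "lie_derivative_metric X G x v w =
     frechet_derivative (\<lambda>y. metric_inner G y v w) (at x) (X x)
     - metric_inner G x (lie_bracket X (\<lambda>_. v) x) w
     - metric_inner G x v (lie_bracket X (\<lambda>_. w) x)"

(* christoffel G k i j = Gamma^k_ij, the Christoffel symbols of the Levi-Civita connection. *)
definition christoffel ::
  "(real^'n \<Rightarrow> real^'n^'n) \<Rightarrow> 'n::finite \<Rightarrow> 'n \<Rightarrow> 'n \<Rightarrow> real^'n \<Rightarrow> real" where
  "christoffel G k i j x =
     1/2 * (\<Sum>l\<in>UNIV. matrix_inv (G x) $ k $ l *
       (partial i (\<lambda>y. G y $ j $ l) x + partial j (\<lambda>y. G y $ i $ l) x - partial l (\<lambda>y. G y $ i $ j) x))"

(* nabla G X Y is the covariant derivative of Y in the direction X. *)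
definition nabla ::
  "(real^'n \<Rightarrow> real^'n^'n) \<Rightarrow> (real^'n \<Rightarrow> real^'n) \<Rightarrow> (real^'n \<Rightarrow> real^'n::finite) \<Rightarrow> real^'n \<Rightarrow> real^'n" where
  "nabla G X Y x = frechet_derivative Y (at x) (X x)
     + (\<chi> k. \<Sum>i\<in>UNIV. \<Sum>j\<in>UNIV. christoffel G k i j x * X x $ i * Y x $ j)"

definition curvature ::
  "(real^'n \<Rightarrow> real^'n^'n) \<Rightarrow> (real^'n \<Rightarrow> real^'n) \<Rightarrow> (real^'n \<Rightarrow> real^'n) \<Rightarrow> (real^'n \<Rightarrow> real^'n::finite)
     \<Rightarrow> real^'n \<Rightarrow> real^'n" where
  "curvature G X Y Z x =
     nabla G X (nabla G Y Z) x - nabla G Y (nabla G X Z) x - nabla G (lie_bracket X Y) Z x"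

(* Ric(v,w) is the trace of u |-> R(u,v)w; tangent vectors are again extended to constant fields. *)
definition ricci :: "(real^'n \<Rightarrow> real^'n^'n::finite) \<Rightarrow> real^'n \<Rightarrow> real^'n \<Rightarrow> real^'n \<Rightarrow> real" where
  "ricci G x v w = trace (matrix (\<lambda>u. curvature G (\<lambda>_. u) (\<lambda>_. v) (\<lambda>_. w) x))"

definition ricci_operator :: "(real^'n \<Rightarrow> real^'n^'n::finite) \<Rightarrow> real^'n \<Rightarrow> real^'n \<Rightarrow> real^'n" where
  "ricci_operator G x v = (THE q. \<forall>w. metric_inner G x q w = ricci G x v w)"

definition scalar_curvature :: "(real^'n \<Rightarrow> real^'n^'n::finite) \<Rightarrow> real^'n \<Rightarrow> real" where
  "scalar_curvature G x = trace (matrix (ricci_operator G x))"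

definition orthonormal_frame_on ::
  "(real^'n \<Rightarrow> real^'n^'n::finite) \<Rightarrow> (real^'n) set \<Rightarrow> ('n \<Rightarrow> real^'n \<Rightarrow> real^'n) \<Rightarrow> bool" where
  "orthonormal_frame_on G W e \<longleftrightarrow>
     (\<forall>i. smooth_on W (e i)) \<and>
     (\<forall>x\<in>W. \<forall>i j. metric_inner G x (e i x) (e j x) = (if i = j then 1 else 0))"

definition frame_laplacian ::
  "(real^'n \<Rightarrow> real^'n^'n) \<Rightarrow> ('n \<Rightarrow> real^'n \<Rightarrow> real^'n) \<Rightarrow> (real^'n \<Rightarrow> real^'n::finite) \<Rightarrow> real^'n \<Rightarrow> real^'n" where
  "frame_laplacian G e X x =
     (\<Sum>i\<in>UNIV. nabla G (e i) (nabla G (e i) X) x - nabla G (nabla G (e i) (e i)) X x)"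

(* The value does not depend on the local orthonormal frame chosen around x. *)
definition vector_laplacian ::
  "(real^'n \<Rightarrow> real^'n^'n) \<Rightarrow> (real^'n \<Rightarrow> real^'n::finite) \<Rightarrow> real^'n \<Rightarrow> real^'n" where
  "vector_laplacian G X x =
     frame_laplacian G (SOME e. \<exists>W. open W \<and> x \<in> W \<and> orthonormal_frame_on G W e) X x"


section \<open>Yamabe solitons\<close>

(* The scalar curvature of g is the function on M with representative scalar_curvature (g c) in
   each chart c; conditions on it are imposed in all charts of the atlas. *)
locale yamabe_soliton = riemannian_manifold M A g
  for M :: "'a topology" and A :: "('a, 'n::finite) chart set"
    and g :: "('a, 'n) chart \<Rightarrow> real^'n \<Rightarrow> real^'n^'n" +
  fixes \<xi> :: "('a, 'n) chart \<Rightarrow> real^'n \<Rightarrow> real^'n" and lam :: real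
  assumes connected: "connected_space M"
    and soliton_field: "smooth_vector_field A \<xi>"
    and soliton_equation:
      "c \<in> A \<Longrightarrow> x \<in> chart_image c \<Longrightarrow>
        1/2 * lie_derivative_metric (\<xi> c) (g c) x v w
        = (scalar_curvature (g c) x - lam) * metric_inner (g c) x v w"

(* The constant is the same in all charts. *)
definition yamabe_metric ::
  "('a, 'n::finite) chart set \<Rightarrow> (('a, 'n) chart \<Rightarrow> real^'n \<Rightarrow> real^'n^'n) \<Rightarrow> bool" where
  "yamabe_metric A g \<longleftrightarrow> (\<exists>k. \<forall>c\<in>A. \<forall>x\<in>chart_image c. scalar_curvature (g c) x = k)"

end

theory Submission
  imports Defs
begin

text \<open>
  Write n for the dimension, R for the scalar curvature and \<rho> = R - \<lambda>. The soliton equation says that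
  the symmetric part of \<nabla>\<xi> is \<rho> times the metric, so \<xi> is a conformal vector field. Differentiating this
  equation once more and commuting covariant derivatives gives Q \<xi> + \<Delta>\<xi> = (2 - n) grad \<rho>
  (\<open>conformal_laplacian\<close>). The hypothesis on \<xi> therefore turns \<xi> into a gradient, namely \<xi> = - grad \<rho> / \<kappa> with
  \<kappa> = \<mu> / (n - 2).

  The covariant derivative of a gradient is symmetric, so \<nabla>\<xi> is exactly \<rho> times the identity
  (\<open>conformal_gradient_cov\<close>). Commuting the second derivatives of \<xi> then gives
  Q \<xi> = (1 - n) grad \<rho> = (n - 1) \<kappa> \<xi> (\<open>conformal_gradient_ric\<close>). The contracted second Bianchi identity,
  evaluated along \<xi> (\<open>contracted_bianchi_along_field\<close>), becomes

  \<xi>(R) = 2 div (Q \<xi>) - 2 tr (Q \<nabla>\<xi>) = 2 n (n - 1) \<kappa> \<rho> - 2 \<rho> R = 2 \<rho> (n (n - 1) \<kappa> - R).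

  Under the two bounds on R this is nonnegative. On the other hand \<xi>(R) = \<xi>(\<rho>) = - \<kappa> g(\<xi>, \<xi>) is nonpositive.
  So \<xi> = 0, and since \<rho> is the factor in \<nabla>\<xi>, also \<rho> = 0, that is R = \<lambda> (\<open>local_soliton_trivial\<close>). All of this
  takes place near a single point, so it can be carried out in each chart separately, and the resulting
  constant is \<lambda> in every chart.

  In a chart, tensors are treated as matrix-valued functions. The connection is given by the matrices
  \<Gamma>_i of Christoffel symbols, for which metric compatibility, the Ricci identity and the second Bianchi
  identity are identities of matrix calculus; index computations are confined to the traces. A smooth
  orthonormal frame serves to evaluate the Laplacian of vector fields and to see that the inverse metric
  is smooth.
\<close>

section \<open>Calculus of smooth maps\<close>

lemma partial_has_derivative:
  "(f has_derivative D) (at x) \<Longrightarrow> partial i f x = D (axis i 1)"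
  unfolding partial_def using frechet_derivative_at[of f D x] by simp

lemma differentiable_imp_has_derivative:
  "f differentiable at x \<Longrightarrow> (f has_derivative frechet_derivative f (at x)) (at x)"
  by (simp add: frechet_derivative_works)

lemma frechet_derivative_eq_sum_partial:
  fixes f :: "real^'n::finite \<Rightarrow> 'b::real_normed_vector"
  assumes "f differentiable at x"
  shows "frechet_derivative f (at x) v = (\<Sum>i\<in>UNIV. v $ i *\<^sub>R partial i f x)"
proof -
  have lin: "linear (frechet_derivative f (at x))"
    using assms by (rule linear_frechet_derivative)
  have "v = (\<Sum>i\<in>UNIV. v $ i *\<^sub>R axis i 1)"
    using basis_expansion[of v] by (simp add: scalar_mult_eq_scaleR)
  then have "frechet_derivative f (at x) v
      = frechet_derivative f (at x) (\<Sum>i\<in>UNIV. v $ i *\<^sub>R axis i 1)"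
    by simp
  then show ?thesis
    by (simp add: linear_sum[OF lin] linear_cmul[OF lin] partial_def)
qed

lemma partial_const [simp]: "partial i (\<lambda>x. c) y = 0"
  by (simp add: partial_def)

lemma partial_add:
  assumes "f differentiable at x" "g differentiable at x"
  shows "partial i (\<lambda>x. f x + g x) x = partial i f x + partial i g x"
  using partial_has_derivative[OF has_derivative_add[OF assms[THEN differentiable_imp_has_derivative]]]
  by (simp add: partial_def)

lemma partial_diff:
  assumes "f differentiable at x" "g differentiable at x"
  shows "partial i (\<lambda>x. f x - g x) x = partial i f x - partial i g x"
  using partial_has_derivative[OF has_derivative_diff[OF assms[THEN differentiable_imp_has_derivative]]]
  by (simp add: partial_def)

lemma partial_sum:
  assumes "\<And>a. a \<in> I \<Longrightarrow> f a differentiable at x"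
  shows "partial i (\<lambda>x. \<Sum>a\<in>I. f a x) x = (\<Sum>a\<in>I. partial i (f a) x)"
  using partial_has_derivative[OF has_derivative_sum[OF assms[THEN differentiable_imp_has_derivative]]]
  by (simp add: partial_def)

lemma partial_bounded_linear:
  assumes "bounded_linear L" "f differentiable at x"
  shows "partial i (\<lambda>x. L (f x)) x = L (partial i f x)"
  using partial_has_derivative[OF bounded_linear.has_derivative[OF assms(1)
        assms(2)[THEN differentiable_imp_has_derivative]]]
  by (simp add: partial_def)

lemma partial_bilinear:
  assumes "bounded_bilinear p" "f differentiable at x" "g differentiable at x"
  shows "partial i (\<lambda>x. p (f x) (g x)) x = p (f x) (partial i g x) + p (partial i f x) (g x)"
  using partial_has_derivative[OF bounded_bilinear.FDERIV[OF assms(1)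
        assms(2-3)[THEN differentiable_imp_has_derivative]]]
  by (simp add: partial_def)

lemma partial_cong:
  assumes "open S" "x \<in> S" "\<And>y. y \<in> S \<Longrightarrow> f y = g y"
  shows "partial i f x = partial i g x"
proof -
  have iff: "(f has_derivative D) (at x) \<longleftrightarrow> (g has_derivative D) (at x)" for D
    using has_derivative_transform_within_open[of f D x UNIV S g]
      has_derivative_transform_within_open[of g D x UNIV S f] assms by auto
  then show ?thesis by (simp add: partial_def frechet_derivative_def)
qed

lemma differentiable_cong:
  assumes "open S" "x \<in> S" "\<And>y. y \<in> S \<Longrightarrow> f y = g y"
  shows "f differentiable at x \<longleftrightarrow> g differentiable at x"
  using has_derivative_transform_within_open[of f _ x UNIV S g]
      has_derivative_transform_within_open[of g _ x UNIV S f] assms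
  unfolding differentiable_def by (metis (no_types, lifting))

lemma Ck_on_cong:
  assumes "open S" "\<And>y. y \<in> S \<Longrightarrow> f y = g y"
  shows "Ck_on k S f \<longleftrightarrow> Ck_on k S g"
  using assms(2)
proof (induction k arbitrary: f g)
  case 0
  then show ?case using continuous_on_cong[of S S f g] by simp
next
  case (Suc k)
  have "partial i f y = partial i g y" if "y \<in> S" for i y
    using partial_cong[OF assms(1) that, of f g] Suc.prems by simp
  then have "Ck_on k S (partial i f) \<longleftrightarrow> Ck_on k S (partial i g)" for i
    using Suc.IH by blast
  moreover have "f differentiable at x \<longleftrightarrow> g differentiable at x" if "x \<in> S" for x
    using differentiable_cong[OF assms(1) that] Suc.prems by blast
  ultimately show ?case by simp
qed

text \<open>The working form of the recursive clause: the partial derivatives only have to agree on the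
  open set with functions that are known to be k times continuously differentiable.\<close>

lemma Ck_on_SucI:
  assumes "open S" "\<And>x. x \<in> S \<Longrightarrow> f differentiable at x"
    "\<And>i x. x \<in> S \<Longrightarrow> partial i f x = h i x" "\<And>i. Ck_on k S (h i)"
  shows "Ck_on (Suc k) S f"
  using assms Ck_on_cong[OF assms(1), of "partial i f" "h i" k for i] by simp

lemma Ck_on_const: "Ck_on k S (\<lambda>x. c)"
proof (induction k arbitrary: c)
  case (Suc k)
  have "partial i (\<lambda>x. c) = (\<lambda>x. 0)" for i :: 'a by auto
  with Suc show ?case by simp
qed simp

lemma Ck_on_continuous: "Ck_on k S f \<Longrightarrow> continuous_on S f"
  by (cases k) (auto intro!: continuous_at_imp_continuous_on differentiable_imp_continuous_within)

lemma Ck_on_mono: "Ck_on (Suc k) S f \<Longrightarrow> Ck_on k S f"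
proof (induction k arbitrary: f)
  case 0
  then show ?case using Ck_on_continuous[OF 0] by simp
next
  case (Suc k)
  then show ?case by (metis Ck_on.simps(2))
qed

lemma Ck_on_bounded_linear:
  assumes "open S" "bounded_linear L" "Ck_on k S f"
  shows "Ck_on k S (\<lambda>x. L (f x))"
  using assms(3)
proof (induction k arbitrary: f)
  case 0
  then show ?case using bounded_linear.continuous_on[OF assms(2)] by simp
next
  case (Suc k)
  have "(\<lambda>x. L (f x)) differentiable at x" if "x \<in> S" for x
    using bounded_linear.has_derivative[OF assms(2)] Suc.prems that
    unfolding differentiable_def Ck_on.simps by blast
  then show ?case
    using Suc assms(1,2)
    by (intro Ck_on_SucI[where h = "\<lambda>i x. L (partial i f x)"]) (auto simp: partial_bounded_linear)
qed

lemma Ck_on_add: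
  assumes "open S" "Ck_on k S f" "Ck_on k S g"
  shows "Ck_on k S (\<lambda>x. f x + g x)"
  using assms(2-3)
proof (induction k arbitrary: f g)
  case 0
  then show ?case by (simp add: continuous_on_add)
next
  case (Suc k)
  show ?case
    using Suc assms(1)
    by (intro Ck_on_SucI[where h = "\<lambda>i x. partial i f x + partial i g x"]) (auto simp: partial_add)
qed

lemma Ck_on_bilinear:
  assumes "open S" "bounded_bilinear p" "Ck_on k S f" "Ck_on k S g"
  shows "Ck_on k S (\<lambda>x. p (f x) (g x))"
  using assms(3-4)
proof (induction k arbitrary: f g)
  case 0
  then show ?case using bounded_bilinear.continuous_on[OF assms(2)] by simp
next
  case (Suc k)
  have "(\<lambda>x. p (f x) (g x)) differentiable at x" if "x \<in> S" for x
    using bounded_bilinear.FDERIV[OF assms(2)] Suc.prems that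
    unfolding differentiable_def Ck_on.simps by blast
  then show ?case
    using Suc assms(1,2) Ck_on_mono[OF Suc.prems(1)] Ck_on_mono[OF Suc.prems(2)]
    by (intro Ck_on_SucI[where h = "\<lambda>i x. p (f x) (partial i g x) + p (partial i f x) (g x)"])
      (auto simp: partial_bilinear intro!: Ck_on_add)
qed

text \<open>The derivative of 1/f is again built from 1/f and the derivative of f, so the induction
  hypothesis for 1/f itself closes the step; the square root is treated in the same way.\<close>

lemma Ck_on_inverse:
  fixes f :: "real^'n::finite \<Rightarrow> real"
  assumes "open S" "\<And>x. x \<in> S \<Longrightarrow> f x \<noteq> 0" "Ck_on k S f"
  shows "Ck_on k S (\<lambda>x. inverse (f x))"
  using assms(3)
proof (induction k)
  case 0
  then show ?case using assms(2) by (simp add: continuous_on_inverse)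
next
  case (Suc k)
  have d: "((\<lambda>x. inverse (f x)) has_derivative
      (\<lambda>h. - (inverse (f x) * frechet_derivative f (at x) h * inverse (f x)))) (at x)"
    if "x \<in> S" for x
    using Suc.prems that assms(2)
    by (intro Deriv.has_derivative_inverse) (auto simp: frechet_derivative_works)
  have "Ck_on k S (\<lambda>x. inverse (f x))" "\<And>i. Ck_on k S (partial i f)"
    using Suc Ck_on_mono by auto
  then have c: "Ck_on k S (\<lambda>x. - (inverse (f x) * partial i f x * inverse (f x)))" for i
    using assms(1)
    by (intro Ck_on_bounded_linear[OF _ bounded_linear_minus[OF bounded_linear_ident]]
        Ck_on_bilinear[OF _ bounded_bilinear_mult]) auto
  show ?case
  proof (rule Ck_on_SucI[OF assms(1) _ _ c])
    show "(\<lambda>x. inverse (f x)) differentiable at x" if "x \<in> S" for x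
      using d[OF that] differentiable_def by blast
    show "partial i (\<lambda>x. inverse (f x)) x = - (inverse (f x) * partial i f x * inverse (f x))"
      if "x \<in> S" for i x
      using partial_has_derivative[OF d[OF that]] by (simp add: partial_def)
  qed
qed

lemma Ck_on_sqrt:
  fixes f :: "real^'n::finite \<Rightarrow> real"
  assumes "open S" "\<And>x. x \<in> S \<Longrightarrow> f x > 0" "Ck_on k S f"
  shows "Ck_on k S (\<lambda>x. sqrt (f x))"
  using assms(3)
proof (induction k)
  case 0
  then show ?case by (simp add: continuous_on_real_sqrt)
next
  case (Suc k)
  have d: "((\<lambda>x. sqrt (f x)) has_derivative
      (\<lambda>h. frechet_derivative f (at x) h * (inverse (sqrt (f x)) / 2))) (at x)"
    if "x \<in> S" for x
    using Suc.prems that assms(2)[OF that]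
    by (intro has_derivative_real_sqrt) (auto simp: frechet_derivative_works)
  have "Ck_on k S (\<lambda>x. inverse (sqrt (f x)))" "\<And>i. Ck_on k S (partial i f)"
    using Suc Ck_on_mono assms(1,2)
    by (auto intro!: Ck_on_inverse) (metis less_irrefl)
  then have c: "Ck_on k S (\<lambda>x. partial i f x * (inverse (sqrt (f x)) / 2))" for i
    using assms(1)
    by (intro Ck_on_bilinear[OF _ bounded_bilinear_mult]
        Ck_on_bounded_linear[OF _ bounded_linear_divide]) auto
  show ?case
  proof (rule Ck_on_SucI[OF assms(1) _ _ c])
    show "(\<lambda>x. sqrt (f x)) differentiable at x" if "x \<in> S" for x
      using d[OF that] differentiable_def by blast
    show "partial i (\<lambda>x. sqrt (f x)) x = partial i f x * (inverse (sqrt (f x)) / 2)"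
      if "x \<in> S" for i x
      using partial_has_derivative[OF d[OF that]] by (simp add: partial_def)
  qed
qed

lemma smooth_on_cong:
  "open S \<Longrightarrow> (\<And>y. y \<in> S \<Longrightarrow> f y = g y) \<Longrightarrow> smooth_on S f \<longleftrightarrow> smooth_on S g"
  unfolding smooth_on_def using Ck_on_cong by blast

lemma smooth_on_differentiable: "smooth_on S f \<Longrightarrow> x \<in> S \<Longrightarrow> f differentiable at x"
  unfolding smooth_on_def by (metis Ck_on.simps(2))

lemma smooth_on_partial: "smooth_on S f \<Longrightarrow> smooth_on S (partial i f)"
  unfolding smooth_on_def by (metis Ck_on.simps(2))

lemma smooth_on_const: "smooth_on S (\<lambda>x. c)"
  by (simp add: smooth_on_def Ck_on_const)

lemma smooth_on_bounded_linear:
  "open S \<Longrightarrow> bounded_linear L \<Longrightarrow> smooth_on S f \<Longrightarrow> smooth_on S (\<lambda>x. L (f x))"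
  by (simp add: smooth_on_def Ck_on_bounded_linear)

lemma smooth_on_bilinear:
  "open S \<Longrightarrow> bounded_bilinear p \<Longrightarrow> smooth_on S f \<Longrightarrow> smooth_on S g
    \<Longrightarrow> smooth_on S (\<lambda>x. p (f x) (g x))"
  by (simp add: smooth_on_def Ck_on_bilinear)

lemma smooth_on_add:
  "open S \<Longrightarrow> smooth_on S f \<Longrightarrow> smooth_on S g \<Longrightarrow> smooth_on S (\<lambda>x. f x + g x)"
  by (simp add: smooth_on_def Ck_on_add)

lemma smooth_on_diff:
  assumes "open S" "smooth_on S f" "smooth_on S g"
  shows "smooth_on S (\<lambda>x. f x - g x)"
  using smooth_on_add[OF assms(1,2)
      smooth_on_bounded_linear[OF assms(1) bounded_linear_minus[OF bounded_linear_ident] assms(3)]]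
  by simp

lemma smooth_on_mult:
  fixes f g :: "real^'n::finite \<Rightarrow> real"
  shows "open S \<Longrightarrow> smooth_on S f \<Longrightarrow> smooth_on S g \<Longrightarrow> smooth_on S (\<lambda>x. f x * g x)"
  by (rule smooth_on_bilinear[OF _ bounded_bilinear_mult])

lemma smooth_on_scaleR:
  "open S \<Longrightarrow> smooth_on S f \<Longrightarrow> smooth_on S g \<Longrightarrow> smooth_on S (\<lambda>x. f x *\<^sub>R g x)"
  by (rule smooth_on_bilinear[OF _ bounded_bilinear_scaleR])

lemma smooth_on_inverse:
  fixes f :: "real^'n::finite \<Rightarrow> real"
  shows "open S \<Longrightarrow> (\<And>x. x \<in> S \<Longrightarrow> f x \<noteq> 0) \<Longrightarrow> smooth_on S f \<Longrightarrow> smooth_on S (\<lambda>x. inverse (f x))"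
  by (simp add: smooth_on_def Ck_on_inverse)

lemma smooth_on_sqrt:
  fixes f :: "real^'n::finite \<Rightarrow> real"
  shows "open S \<Longrightarrow> (\<And>x. x \<in> S \<Longrightarrow> f x > 0) \<Longrightarrow> smooth_on S f \<Longrightarrow> smooth_on S (\<lambda>x. sqrt (f x))"
  by (simp add: smooth_on_def Ck_on_sqrt)

lemma smooth_on_sum:
  assumes "open S" "\<And>a. a \<in> I \<Longrightarrow> smooth_on S (f a)"
  shows "smooth_on S (\<lambda>x. \<Sum>a\<in>I. f a x)"
proof (cases "finite I")
  case True
  then show ?thesis
    using assms(2) by (induction I) (auto intro!: smooth_on_const smooth_on_add[OF assms(1)])
qed (simp add: smooth_on_const)

lemma bounded_linear_axis: "bounded_linear (axis i :: 'b::real_normed_vector \<Rightarrow> 'b^'n::finite)"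
proof (rule bounded_linear_intro[where K = 1])
  show "norm (axis i x :: 'b^'n) \<le> norm x * 1" for x :: 'b
    by (simp add: norm_axis_1 norm_vec_def axis_def L2_set_def if_distrib if_distribR cong: if_cong)
qed (auto simp: vec_eq_iff axis_def)

text \<open>Reduces smoothness of vectors and matrices to that of their entries, through the expansion
  in the standard basis.\<close>

lemma smooth_on_vec_lambda:
  assumes "open S" "\<And>i. smooth_on S (\<lambda>x. f i x)"
  shows "smooth_on S (\<lambda>x. \<chi> i. f i x)"
proof -
  have "smooth_on S (\<lambda>x. \<Sum>i\<in>UNIV. axis i (f i x))"
    by (intro smooth_on_sum smooth_on_bounded_linear[OF _ bounded_linear_axis] assms)
  moreover have "(\<chi> i. f i x) = (\<Sum>i\<in>UNIV. axis i (f i x))" for x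
    by (simp add: vec_eq_iff axis_def)
  ultimately show ?thesis by simp
qed

lemma smooth_on_nth: "open S \<Longrightarrow> smooth_on S f \<Longrightarrow> smooth_on S (\<lambda>x. f x $ i)"
  by (rule smooth_on_bounded_linear[OF _ bounded_linear_vec_nth])

lemma partial_nth: "f differentiable at x \<Longrightarrow> partial i (\<lambda>x. f x $ j) x = partial i f x $ j"
  by (rule partial_bounded_linear[OF bounded_linear_vec_nth])

section \<open>Symmetry of second derivatives\<close>

text \<open>The second difference of f over a square of side h is symmetric in the two directions. Using
  the mean value theorem first in direction i and then in direction j turns it into a value of the
  mixed partial derivative near x; exchanging the directions gives the other mixed partial
  derivative, and letting h tend to 0 identifies the two.\<close>

lemma second_difference_eq_mixed_partial:
  fixes f :: "real^'n::finite \<Rightarrow> real"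
  assumes h: "h > 0" and ball: "cball x (2 * h) \<subseteq> S"
    and f: "\<And>y. y \<in> S \<Longrightarrow> f differentiable at y"
    and pf: "\<And>y. y \<in> S \<Longrightarrow> partial i f differentiable at y"
  shows "\<exists>y \<in> cball x (2 * h). f (x + h *\<^sub>R axis i 1 + h *\<^sub>R axis j 1) - f (x + h *\<^sub>R axis i 1)
      - (f (x + h *\<^sub>R axis j 1) - f x) = h * h * partial j (partial i f) y"
proof -
  have mem: "x + s *\<^sub>R axis i 1 + t *\<^sub>R axis j 1 \<in> cball x (2 * h)"
    if "0 \<le> s" "s \<le> h" "0 \<le> t" "t \<le> h" for s t
    using norm_triangle_ineq[of "s *\<^sub>R axis i 1" "t *\<^sub>R axis j 1 :: real^'n"] that
    by (simp add: dist_norm norm_minus_commute norm_axis_1 algebra_simps)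
  have d1: "((\<lambda>s. g (z + s *\<^sub>R axis k 1)) has_derivative (\<lambda>u. u * partial k g (z + s *\<^sub>R axis k 1))) (at s)"
    if "g differentiable at (z + s *\<^sub>R axis k 1)" for g :: "real^'n \<Rightarrow> real" and z s k
  proof -
    have lin: "linear (frechet_derivative g (at (z + s *\<^sub>R axis k 1)))"
      using that by (rule linear_frechet_derivative)
    have "((\<lambda>s. z + s *\<^sub>R axis k 1) has_derivative (\<lambda>u. u *\<^sub>R axis k 1)) (at s)"
      by (rule derivative_eq_intros refl)+ simp
    from has_derivative_compose[where f = "\<lambda>s. z + s *\<^sub>R axis k 1" and g = g,
        OF this differentiable_imp_has_derivative[OF that]]
    show ?thesis by (simp add: linear_cmul[OF lin] partial_def)
  qed
  define \<psi> where "\<psi> s = f ((x + h *\<^sub>R axis j 1) + s *\<^sub>R axis i 1) - f (x + s *\<^sub>R axis i 1)" for s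
  define \<psi>' where "\<psi>' s = partial i f ((x + h *\<^sub>R axis j 1) + s *\<^sub>R axis i 1)
      - partial i f (x + s *\<^sub>R axis i 1)" for s
  have "(\<psi> has_derivative (\<lambda>u. u * \<psi>' s)) (at s within {0..h})" if "s \<in> {0..h}" for s
  proof -
    have a: "x + s *\<^sub>R axis i 1 \<in> S" "x + h *\<^sub>R axis j 1 + s *\<^sub>R axis i 1 \<in> S"
      using subsetD[OF ball mem[of s 0]] subsetD[OF ball mem[of s h]] that h by (simp_all add: add_ac)
    show ?thesis
      unfolding \<psi>_def \<psi>'_def right_diff_distrib
      by (rule has_derivative_at_withinI, rule has_derivative_diff) (rule d1, rule f, rule a)+
  qed
  from mvt_simple[OF h this] obtain s where s: "0 < s" "s < h" "\<psi> h - \<psi> 0 = h * \<psi>' s"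
    by auto
  define \<theta> where "\<theta> t = partial i f ((x + s *\<^sub>R axis i 1) + t *\<^sub>R axis j 1)" for t
  have d\<theta>: "(\<theta> has_derivative
      (\<lambda>u. u * partial j (partial i f) ((x + s *\<^sub>R axis i 1) + t *\<^sub>R axis j 1))) (at t within {0..h})"
    if "t \<in> {0..h}" for t
  proof -
    have "x + s *\<^sub>R axis i 1 + t *\<^sub>R axis j 1 \<in> S"
      using subsetD[OF ball mem[of s t]] that s(1,2) by simp
    then show ?thesis
      unfolding \<theta>_def by (rule has_derivative_at_withinI[OF d1[OF pf]])
  qed
  obtain t where t: "t \<in> {0<..<h}"
    "\<theta> h - \<theta> 0 = (h - 0) * partial j (partial i f) (x + s *\<^sub>R axis i 1 + t *\<^sub>R axis j 1)"
    using mvt_simple[OF h, of \<theta>, OF d\<theta>] by fastforce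
  have "\<psi> h - \<psi> 0 = h * h * partial j (partial i f) (x + s *\<^sub>R axis i 1 + t *\<^sub>R axis j 1)"
    using s(3) t(2) by (simp add: \<psi>'_def \<theta>_def add_ac)
  then show ?thesis
    using mem[of s t] s t by (intro bexI[of _ "x + s *\<^sub>R axis i 1 + t *\<^sub>R axis j 1"])
      (auto simp: \<psi>_def algebra_simps)
qed

lemma mixed_partials_commute_real:
  fixes f :: "real^'n::finite \<Rightarrow> real"
  assumes "open S" "x \<in> S" "smooth_on S f"
  shows "partial i (partial j f) x = partial j (partial i f) x"
proof (rule ccontr)
  assume neq: "partial i (partial j f) x \<noteq> partial j (partial i f) x"
  define e where "e = \<bar>partial i (partial j f) x - partial j (partial i f) x\<bar> / 2"
  have e: "e > 0" using neq by (simp add: e_def)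
  have sm: "smooth_on S (partial k (partial l f))" for k l
    using assms smooth_on_partial by blast
  then have cont: "continuous (at x) (partial k (partial l f))" for k l
    using assms(2) by (auto dest: smooth_on_differentiable differentiable_imp_continuous_within)
  obtain d where d: "d > 0" "\<And>y. dist y x < d \<Longrightarrow> \<bar>partial i (partial j f) y - partial i (partial j f) x\<bar> < e"
    using cont[of i j] e unfolding continuous_at_eps_delta dist_real_def by blast
  obtain d' where d': "d' > 0" "\<And>y. dist y x < d' \<Longrightarrow> \<bar>partial j (partial i f) y - partial j (partial i f) x\<bar> < e"
    using cont[of j i] e unfolding continuous_at_eps_delta dist_real_def by blast
  obtain r where r: "r > 0" "cball x r \<subseteq> S"
    using assms(1,2) open_contains_cball by blast
  define h where "h = min r (min d d') / 3"
  have h: "h > 0" "2 * h < d" "2 * h < d'" "2 * h \<le> r"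
    using d(1) d'(1) r(1) by (auto simp: h_def)
  have ball: "cball x (2 * h) \<subseteq> S" using r(2) h(4) by (meson subset_cball order_trans)
  have df: "f differentiable at y" "partial k f differentiable at y" if "y \<in> S" for y k
    using that assms(3) smooth_on_partial smooth_on_differentiable by blast+
  obtain y where y: "y \<in> cball x (2 * h)" "f (x + h *\<^sub>R axis i 1 + h *\<^sub>R axis j 1) - f (x + h *\<^sub>R axis i 1)
      - (f (x + h *\<^sub>R axis j 1) - f x) = h * h * partial j (partial i f) y"
    using second_difference_eq_mixed_partial[OF h(1) ball df] by blast
  obtain z where z: "z \<in> cball x (2 * h)" "f (x + h *\<^sub>R axis j 1 + h *\<^sub>R axis i 1) - f (x + h *\<^sub>R axis j 1)
      - (f (x + h *\<^sub>R axis i 1) - f x) = h * h * partial i (partial j f) z"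
    using second_difference_eq_mixed_partial[OF h(1) ball df] by blast
  have "h * h * partial j (partial i f) y = h * h * partial i (partial j f) z"
    using y(2) z(2) by (simp add: algebra_simps)
  then have "partial j (partial i f) y = partial i (partial j f) z"
    using h(1) by simp
  moreover have "\<bar>partial j (partial i f) y - partial j (partial i f) x\<bar> < e"
    using d'(2)[of y] y(1) h by (simp add: dist_commute)
  moreover have "\<bar>partial i (partial j f) z - partial i (partial j f) x\<bar> < e"
    using d(2)[of z] z(1) h by (simp add: dist_commute)
  ultimately show False unfolding e_def by (auto simp: abs_if split: if_splits)
qed

text \<open>The vector-valued case, needed for matrix-valued functions, follows by testing against a basis.\<close>

lemma mixed_partials_commute:
  fixes f :: "real^'n::finite \<Rightarrow> 'b::euclidean_space"
  assumes "open S" "x \<in> S" "smooth_on S f"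
  shows "partial i (partial j f) x = partial j (partial i f) x"
proof (rule euclidean_eqI)
  fix b :: 'b
  have bl: "bounded_linear (\<lambda>v::'b. v \<bullet> b)" by (rule bounded_linear_inner_left)
  have eq: "partial k (\<lambda>y. f y \<bullet> b) y = partial k f y \<bullet> b" if "y \<in> S" for k y
    using that assms(3) by (intro partial_bounded_linear[OF bl] smooth_on_differentiable)
  have "partial k (partial l f) x \<bullet> b = partial k (partial l (\<lambda>y. f y \<bullet> b)) x" for k l
  proof -
    have "partial k (partial l (\<lambda>y. f y \<bullet> b)) x = partial k (\<lambda>y. partial l f y \<bullet> b) x"
      using eq by (intro partial_cong[OF assms(1,2)])
    also have "\<dots> = partial k (partial l f) x \<bullet> b"
      using assms by (intro partial_bounded_linear[OF bl] smooth_on_differentiable smooth_on_partial)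
    finally show ?thesis by simp
  qed
  then show "partial i (partial j f) x \<bullet> b = partial j (partial i f) x \<bullet> b"
    using mixed_partials_commute_real[OF assms(1,2) smooth_on_bounded_linear[OF assms(1) bl assms(3)]]
    by simp
qed

section \<open>Matrix algebra\<close>

lemma matrix_add_rdistrib: "(A + B) ** C = A ** C + B ** (C :: real^'p::finite^'n::finite)"
  by (simp add: matrix_matrix_mult_def vec_eq_iff sum.distrib algebra_simps)

lemma matrix_diff_ldistrib: "A ** (B - C) = A ** B - A ** (C :: real^'p::finite^'n::finite)"
  by (simp add: matrix_matrix_mult_def vec_eq_iff sum_subtractf algebra_simps)

lemma matrix_diff_rdistrib: "(A - B) ** C = A ** C - B ** (C :: real^'p::finite^'n::finite)"
  by (simp add: matrix_matrix_mult_def vec_eq_iff sum_subtractf algebra_simps)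

lemma matrix_minus_left: "(- A) ** C = - (A ** (C :: real^'p::finite^'n::finite))"
  by (simp add: matrix_matrix_mult_def vec_eq_iff sum_negf)

lemma matrix_minus_right: "A ** (- C) = - (A ** (C :: real^'p::finite^'n::finite))"
  by (simp add: matrix_matrix_mult_def vec_eq_iff sum_negf)

lemma transpose_add: "transpose (A + B) = transpose A + transpose (B :: real^'m^'n)"
  by (simp add: transpose_def vec_eq_iff)

lemma transpose_diff: "transpose (A - B) = transpose A - transpose (B :: real^'m^'n)"
  by (simp add: transpose_def vec_eq_iff)

lemma transpose_nth: "transpose A $ i $ j = A $ j $ i"
  by (simp add: transpose_def)

lemma trace_transpose: "trace (transpose A) = trace (A :: real^'n^'n)"
  by (simp add: trace_def transpose_def)

lemma trace_scaleR: "trace (c *\<^sub>R A) = c * trace (A :: real^'n^'n)"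
  by (simp add: trace_def sum_distrib_left)

lemma matrix_mult_nth: "(A ** B) $ i $ j = (\<Sum>k\<in>UNIV. A $ i $ k * B $ k $ j)"
  by (simp add: matrix_matrix_mult_def)

lemma matrix_vector_nth: "(A *v v) $ i = (\<Sum>k\<in>UNIV. A $ i $ k * v $ k)"
  by (simp add: matrix_vector_mult_def)

lemma matrix_vector_axis_nth: "((A :: real^'n^'m) *v axis j 1) $ i = A $ i $ j"
  by (simp add: matrix_vector_mult_def axis_def if_distrib cong: if_cong)

lemma trace_mult_transpose: "trace (A ** transpose B) = (\<Sum>i\<in>UNIV. \<Sum>k\<in>UNIV. A $ i $ k * (B :: real^'n^'m) $ i $ k)"
  by (simp add: trace_def matrix_matrix_mult_def transpose_def)

lemmas matrix_distribs = matrix_add_ldistrib matrix_add_rdistrib matrix_diff_ldistrib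
  matrix_diff_rdistrib matrix_minus_left matrix_minus_right

lemma bounded_bilinear_matrix_mult:
  "bounded_bilinear ((**) :: real^'m::finite^'n::finite \<Rightarrow> real^'p::finite^'m \<Rightarrow> real^'p^'n)"
  unfolding bilinear_conv_bounded_bilinear[symmetric] bilinear_def
  by (auto intro!: linearI simp: matrix_distribs matrix_scalar_ac scalar_matrix_assoc)

lemma bounded_bilinear_matrix_vector:
  "bounded_bilinear ((*v) :: real^'m::finite^'n::finite \<Rightarrow> real^'m \<Rightarrow> real^'n)"
  unfolding bilinear_conv_bounded_bilinear[symmetric] bilinear_def
  by (auto intro!: linearI simp: matrix_vector_right_distrib matrix_vector_mult_add_rdistrib
      matrix_vector_mult_scaleR scaleR_matrix_vector_assoc)

lemma bounded_linear_transpose: "bounded_linear (transpose :: real^'m::finite^'n::finite \<Rightarrow> real^'n^'m)"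
  by (intro linear_conv_bounded_linear[THEN iffD1] linearI) (simp_all add: transpose_add transpose_scalar)

lemma bounded_linear_trace: "bounded_linear (trace :: real^'n::finite^'n \<Rightarrow> real)"
  by (intro linear_conv_bounded_linear[THEN iffD1] linearI) (simp_all add: trace_add trace_scaleR)

lemma smooth_on_matrix_mult:
  fixes A :: "real^'k::finite \<Rightarrow> real^'m::finite^'n::finite" and B :: "real^'k \<Rightarrow> real^'p::finite^'m"
  shows "open S \<Longrightarrow> smooth_on S A \<Longrightarrow> smooth_on S B \<Longrightarrow> smooth_on S (\<lambda>x. A x ** B x)"
  by (rule smooth_on_bilinear[OF _ bounded_bilinear_matrix_mult])

lemma smooth_on_matrix_vector:
  fixes A :: "real^'k::finite \<Rightarrow> real^'m::finite^'n::finite" and v :: "real^'k \<Rightarrow> real^'m"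
  shows "open S \<Longrightarrow> smooth_on S A \<Longrightarrow> smooth_on S v \<Longrightarrow> smooth_on S (\<lambda>x. A x *v v x)"
  by (rule smooth_on_bilinear[OF _ bounded_bilinear_matrix_vector])

lemma smooth_on_inner:
  fixes v w :: "real^'k::finite \<Rightarrow> 'b::real_inner"
  shows "open S \<Longrightarrow> smooth_on S v \<Longrightarrow> smooth_on S w \<Longrightarrow> smooth_on S (\<lambda>x. v x \<bullet> w x)"
  by (rule smooth_on_bilinear[OF _ bounded_bilinear_inner])

lemma smooth_on_transpose:
  fixes A :: "real^'k::finite \<Rightarrow> real^'m::finite^'n::finite"
  shows "open S \<Longrightarrow> smooth_on S A \<Longrightarrow> smooth_on S (\<lambda>x. transpose (A x))"
  by (rule smooth_on_bounded_linear[OF _ bounded_linear_transpose])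

lemma smooth_on_trace:
  fixes A :: "real^'k::finite \<Rightarrow> real^'n::finite^'n"
  shows "open S \<Longrightarrow> smooth_on S A \<Longrightarrow> smooth_on S (\<lambda>x. trace (A x))"
  by (rule smooth_on_bounded_linear[OF _ bounded_linear_trace])

lemmas smooth_rules = smooth_on_matrix_mult smooth_on_matrix_vector smooth_on_inner
  smooth_on_transpose smooth_on_trace smooth_on_add smooth_on_diff smooth_on_scaleR smooth_on_mult
  smooth_on_vec_lambda smooth_on_nth smooth_on_const smooth_on_partial smooth_on_sum

section \<open>Metrics on a coordinate domain\<close>

text \<open>What a Riemannian metric looks like in one chart: the matrix of its components on the open
  image of the chart.\<close>

locale local_metric =
  fixes U :: "(real^'n::finite) set" and G :: "real^'n \<Rightarrow> real^'n^'n"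
  assumes open_domain: "open U"
    and smooth_metric: "smooth_on U G"
    and symmetric_metric: "x \<in> U \<Longrightarrow> transpose (G x) = G x"
    and positive_metric: "x \<in> U \<Longrightarrow> v \<noteq> 0 \<Longrightarrow> v \<bullet> (G x *v v) > 0"

lemma metric_inner_eq: "metric_inner G x v w = v \<bullet> (G x *v w)"
  by (simp add: metric_inner_def inner_vec_def matrix_vector_mult_def sum_distrib_left ac_simps)

lemma inner_axis_matrix_axis: "axis i 1 \<bullet> ((A :: real^'n^'n) *v axis j 1) = A $ i $ j"
  by (simp add: inner_axis' matrix_vector_axis_nth)

context local_metric begin

lemma metric_nth_commute: "x \<in> U \<Longrightarrow> G x $ i $ j = G x $ j $ i"
  using symmetric_metric[of x] by (metis transpose_nth)

lemma metric_commute: "x \<in> U \<Longrightarrow> v \<bullet> (G x *v w) = w \<bullet> (G x *v v)"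
  by (metis dot_lmul_matrix inner_commute symmetric_metric transpose_matrix_vector)

lemma transpose_mult_metric: "x \<in> U \<Longrightarrow> transpose B ** G x = transpose (G x ** B)"
  by (simp add: matrix_transpose_mul symmetric_metric)

text \<open>Gram-Schmidt, applied to the coordinate fields one index at a time. Besides orthonormality the
  induction carries along that the fields constructed so far only have components with indices
  treated so far; this keeps the next coordinate field independent of them.\<close>

lemma exists_orthonormal_frame: "\<exists>e. orthonormal_frame_on G U e"
proof -
  have "\<exists>e :: 'n \<Rightarrow> real^'n \<Rightarrow> real^'n. (\<forall>i\<in>S. smooth_on U (e i)) \<and>
      (\<forall>i\<in>S. \<forall>j. j \<notin> S \<longrightarrow> (\<forall>x\<in>U. e i x $ j = 0)) \<and>
      (\<forall>x\<in>U. \<forall>i\<in>S. \<forall>j\<in>S. e i x \<bullet> (G x *v e j x) = (if i = j then 1 else 0))"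
    if "finite S" for S :: "'n set"
    using that
  proof (induction S)
    case empty
    show ?case by simp
  next
    case (insert a S)
    then obtain e :: "'n \<Rightarrow> real^'n \<Rightarrow> real^'n" where
      sm: "\<And>i. i \<in> S \<Longrightarrow> smooth_on U (e i)" and
      supp: "\<And>i j x. i \<in> S \<Longrightarrow> j \<notin> S \<Longrightarrow> x \<in> U \<Longrightarrow> e i x $ j = 0" and
      on: "\<And>i j x. i \<in> S \<Longrightarrow> j \<in> S \<Longrightarrow> x \<in> U \<Longrightarrow> e i x \<bullet> (G x *v e j x) = (if i = j then 1 else 0)"
      by blast
    define w where "w x = axis a 1 - (\<Sum>i\<in>S. (axis a 1 \<bullet> (G x *v e i x)) *\<^sub>R e i x)" for x
    define q where "q x = w x \<bullet> (G x *v w x)" for x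
    define e' where "e' i x = (if i = a then inverse (sqrt (q x)) *\<^sub>R w x else e i x)" for i x
    have w_smooth: "smooth_on U w"
      unfolding w_def by (intro smooth_rules open_domain smooth_metric sm)
    \<comment> \<open>The earlier fields have no component in direction a, so w does not vanish.\<close>
    have "w x $ a = 1" if "x \<in> U" for x
      using insert.hyps(2) supp[of _ a x] that by (simp add: w_def)
    then have w_nz: "w x \<noteq> 0" if "x \<in> U" for x using that by force
    then have q_pos: "q x > 0" if "x \<in> U" for x using positive_metric that by (simp add: q_def)
    have e'a: "e' a = (\<lambda>x. inverse (sqrt (q x)) *\<^sub>R w x)" and e'S: "i \<in> S \<Longrightarrow> e' i = e i" for i
      using insert.hyps(2) by (auto simp: e'_def fun_eq_iff)
    have q_smooth: "smooth_on U q"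
      unfolding q_def by (intro smooth_rules open_domain smooth_metric w_smooth)
    have sqrt_nz: "sqrt (q x) \<noteq> 0" if "x \<in> U" for x using q_pos[OF that] by simp
    have sma: "smooth_on U (e' a)"
      unfolding e'a
      by (intro smooth_on_scaleR smooth_on_inverse smooth_on_sqrt open_domain q_smooth w_smooth sqrt_nz q_pos)
    have orth: "w x \<bullet> (G x *v e k x) = 0" if "x \<in> U" "k \<in> S" for x k
    proof -
      have "(\<Sum>i\<in>S. axis a 1 \<bullet> (G x *v e i x) * (e i x \<bullet> (G x *v e k x)))
          = axis a 1 \<bullet> (G x *v e k x)"
        using insert.hyps(1) that by (simp add: on if_distrib cong: if_cong)
      then show ?thesis by (simp add: w_def inner_diff_left inner_sum_left)
    qed
    have norm: "e' a x \<bullet> (G x *v e' a x) = 1" if "x \<in> U" for x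
    proof -
      have "inverse (sqrt (q x)) * (inverse (sqrt (q x)) * q x) = 1"
        using q_pos[OF that] by (simp add: field_simps)
      then show ?thesis by (simp add: e'a matrix_vector_mult_scaleR q_def)
    qed
    have orth': "e' a x \<bullet> (G x *v e k x) = 0" "e k x \<bullet> (G x *v e' a x) = 0"
      if "x \<in> U" "k \<in> S" for x k
      using orth[OF that] metric_commute[OF that(1), of "w x" "e k x"]
      by (simp_all add: e'a matrix_vector_mult_scaleR)
    have "(\<forall>i\<in>insert a S. smooth_on U (e' i)) \<and>
      (\<forall>i\<in>insert a S. \<forall>j. j \<notin> insert a S \<longrightarrow> (\<forall>x\<in>U. e' i x $ j = 0)) \<and>
      (\<forall>x\<in>U. \<forall>i\<in>insert a S. \<forall>j\<in>insert a S. e' i x \<bullet> (G x *v e' j x) = (if i = j then 1 else 0))"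
    proof (intro conjI ballI allI impI)
      show "smooth_on U (e' i)" if "i \<in> insert a S" for i
        using that sma sm e'S by auto
    next
      fix i j x assume "i \<in> insert a S" "j \<notin> insert a S" "x \<in> U"
      moreover have "w x $ j = 0" if "j \<noteq> a" "j \<notin> S"
        using supp that \<open>x \<in> U\<close> by (simp add: w_def axis_def)
      ultimately show "e' i x $ j = 0"
        using supp by (auto simp: e'_def)
    next
      fix x i j assume "x \<in> U" "i \<in> insert a S" "j \<in> insert a S"
      then show "e' i x \<bullet> (G x *v e' j x) = (if i = j then 1 else 0)"
        using insert.hyps(2) norm orth' on e'S by (cases "i = a"; cases "j = a") auto
    qed
    then show ?case by blast
  qed
  from this[of UNIV] show ?thesis
    by (auto simp: orthonormal_frame_on_def metric_inner_eq)
qed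

definition cometric :: "real^'n \<Rightarrow> real^'n^'n" where "cometric x = matrix_inv (G x)"

text \<open>For the matrix E whose columns are the frame fields, orthonormality reads E^T G E = 1. Cancelling on the other side gives
  E E^T = G^-1, the completeness relation of the frame. It exhibits the inverse metric as a smooth
  function, and it is what makes traces over the frame independent of the frame.\<close>

lemma frame_completeness:
  assumes "orthonormal_frame_on G W e" "x \<in> W" "x \<in> U"
  shows inverse_metric_left: "cometric x ** G x = mat 1"
    and inverse_metric_right: "G x ** cometric x = mat 1"
    and inverse_metric_eq_frame: "cometric x = (\<chi> i j. \<Sum>a\<in>UNIV. e a x $ i * e a x $ j)"
proof -
  define E :: "real^'n^'n" where "E = (\<chi> i a. e a x $ i)"
  have "transpose E ** G x ** E = mat 1"
  proof -
    have "(transpose E ** G x ** E) $ i $ j = metric_inner G x (e i x) (e j x)" for i j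
      by (simp add: matrix_mult_nth E_def transpose_def metric_inner_def sum_distrib_right)
        (subst sum.swap, simp add: ac_simps)
    then show ?thesis
      using assms by (simp add: vec_eq_iff orthonormal_frame_on_def mat_def)
  qed
  then have left: "(E ** transpose E) ** G x = mat 1"
    using matrix_left_right_inverse[of "transpose E ** G x" E] by (simp add: matrix_mul_assoc)
  then have "G x ** (E ** transpose E) = mat 1"
    using matrix_left_right_inverse by blast
  then have "invertible (G x)" using left by (auto simp: invertible_def)
  then have *: "G x ** cometric x = mat 1 \<and> cometric x ** G x = mat 1"
    unfolding cometric_def matrix_inv_def invertible_def by (rule someI_ex)
  then show "cometric x ** G x = mat 1" "G x ** cometric x = mat 1" by auto
  have "cometric x = (E ** transpose E) ** G x ** cometric x" using left by simp
  also have "\<dots> = E ** transpose E" using * by (simp add: matrix_mul_assoc[symmetric])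
  finally show "cometric x = (\<chi> i j. \<Sum>a\<in>UNIV. e a x $ i * e a x $ j)"
    by (simp add: vec_eq_iff matrix_mult_nth E_def transpose_def)
qed

lemma cometric_left: "x \<in> U \<Longrightarrow> cometric x ** G x = mat 1"
  and cometric_right: "x \<in> U \<Longrightarrow> G x ** cometric x = mat 1"
  using exists_orthonormal_frame inverse_metric_left inverse_metric_right by blast+

lemma trace_metric_symmetrization:
  assumes "x \<in> U"
  shows "trace (cometric x ** (transpose B ** G x + G x ** B)) = 2 * trace B"
proof -
  have "trace (cometric x ** (transpose B ** G x)) = trace (transpose B ** (G x ** cometric x))"
    by (subst trace_mul_sym) (simp add: matrix_mul_assoc)
  moreover have "trace (cometric x ** (G x ** B)) = trace B"
    by (simp add: matrix_mul_assoc cometric_left assms)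
  ultimately show ?thesis
    using assms by (simp add: matrix_add_ldistrib trace_add cometric_right trace_transpose)
qed

lemma cometric_smooth: "smooth_on U cometric"
proof -
  obtain e where e: "orthonormal_frame_on G U e" using exists_orthonormal_frame by blast
  then have sm: "smooth_on U (e a)" for a by (simp add: orthonormal_frame_on_def)
  have "smooth_on U (\<lambda>x. \<chi> i j. \<Sum>a\<in>UNIV. e a x $ i * e a x $ j)"
    by (intro smooth_rules open_domain sm)
  then show ?thesis
    using smooth_on_cong[OF open_domain, of cometric "\<lambda>x. \<chi> i j. \<Sum>a\<in>UNIV. e a x $ i * e a x $ j"]
      inverse_metric_eq_frame[OF e] by blast
qed

lemma cometric_symmetric: "x \<in> U \<Longrightarrow> transpose (cometric x) = cometric x"
  using exists_orthonormal_frame inverse_metric_eq_frame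
  by (fastforce simp: vec_eq_iff transpose_def mult.commute)

lemma cometric_nth_commute: "x \<in> U \<Longrightarrow> cometric x $ i $ j = cometric x $ j $ i"
  by (metis cometric_symmetric transpose_nth)

lemma diff_at: "smooth_on U f \<Longrightarrow> x \<in> U \<Longrightarrow> f differentiable at x"
  by (rule smooth_on_differentiable)

section \<open>The Levi-Civita connection\<close>

text \<open>The matrix of the connection form in the i-th coordinate direction, so that the covariant
  derivative in that direction is the partial derivative plus this matrix.\<close>

definition conn :: "'n \<Rightarrow> real^'n \<Rightarrow> real^'n^'n" where
  "conn i x = (\<chi> k j. christoffel G k i j x)"

text \<open>The bracket of the Koszul formula: G \<Gamma>_i is half of this matrix.\<close>

definition koszul :: "'n \<Rightarrow> real^'n \<Rightarrow> real^'n^'n" where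
  "koszul i x = (\<chi> l j. partial i G x $ j $ l + partial j G x $ i $ l - partial l G x $ i $ j)"

lemma partial_metric_nth: "x \<in> U \<Longrightarrow> partial l (\<lambda>y. G y $ i $ j) x = partial l G x $ i $ j"
  by (simp add: partial_nth diff_at[OF smooth_metric] diff_at[OF smooth_on_nth[OF open_domain smooth_metric]])

lemma partial_metric_commute:
  assumes "x \<in> U" shows "partial l G x $ i $ j = partial l G x $ j $ i"
proof -
  have "partial l (\<lambda>y. G y $ i $ j) x = partial l (\<lambda>y. G y $ j $ i) x"
    using metric_nth_commute by (intro partial_cong[OF open_domain assms])
  then show ?thesis by (simp add: partial_metric_nth assms)
qed

lemma conn_eq_koszul: "x \<in> U \<Longrightarrow> conn i x = (1/2) *\<^sub>R (cometric x ** koszul i x)"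
  by (simp add: vec_eq_iff conn_def christoffel_def koszul_def matrix_mult_nth cometric_def partial_metric_nth)

lemma conn_smooth: "smooth_on U (conn i)"
proof -
  have "smooth_on U (\<lambda>x. (1/2) *\<^sub>R (cometric x ** koszul i x))"
    unfolding koszul_def by (intro smooth_rules open_domain smooth_metric cometric_smooth)
  then show ?thesis
    using smooth_on_cong[OF open_domain, of "conn i" "\<lambda>x. (1/2) *\<^sub>R (cometric x ** koszul i x)"] conn_eq_koszul
    by blast
qed

lemma torsion_free: "x \<in> U \<Longrightarrow> conn i x $ k $ j = conn j x $ k $ i"
  by (simp add: conn_eq_koszul matrix_mult_nth koszul_def partial_metric_commute[of x _ i j] algebra_simps)

text \<open>Lowering the upper index, G \<Gamma>_i is half of the Koszul matrix, and its antisymmetric terms cancel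
  against those of the transpose.\<close>

lemma metric_compatible:
  assumes "x \<in> U"
  shows "partial m G x = transpose (conn m x) ** G x + G x ** conn m x"
proof -
  have 1: "G x ** conn m x = (1/2) *\<^sub>R koszul m x"
    using assms by (simp add: conn_eq_koszul matrix_scalar_ac matrix_mul_assoc cometric_right scalar_matrix_assoc[symmetric])
  have "partial m G x $ a $ b = (transpose (conn m x) ** G x + G x ** conn m x) $ a $ b" for a b
    unfolding transpose_mult_metric[OF assms] 1
    using partial_metric_commute[OF assms, of m a b] partial_metric_commute[OF assms, of a m b]
      partial_metric_commute[OF assms, of b m a]
    by (simp add: transpose_def koszul_def field_simps)
  then show ?thesis by (simp add: vec_eq_iff)
qed

text \<open>Differentiate G^-1 G = 1: the inverse metric is parallel as well.\<close>

lemma partial_inverse_metric: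
  assumes "x \<in> U"
  shows "partial m cometric x = - (conn m x ** cometric x) - cometric x ** transpose (conn m x)"
proof -
  have "partial m (\<lambda>y. cometric y ** G y) x = partial m (\<lambda>y. mat 1) x"
    using cometric_left by (intro partial_cong[OF open_domain assms])
  then have "cometric x ** partial m G x + partial m cometric x ** G x = 0"
    using assms by (simp add: partial_bilinear[OF bounded_bilinear_matrix_mult] diff_at cometric_smooth smooth_metric)
  then have "partial m cometric x ** G x = - (cometric x ** partial m G x)"
    by (simp add: add_eq_0_iff)
  then have "(partial m cometric x ** G x) ** cometric x = - (cometric x ** partial m G x) ** cometric x"
    by simp
  moreover have "(cometric x ** partial m G x) ** cometric x = cometric x ** transpose (conn m x) ** (G x ** cometric x)
      + (cometric x ** G x) ** conn m x ** cometric x"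
    unfolding metric_compatible[OF assms] by (simp only: matrix_distribs matrix_mul_assoc)
  ultimately show ?thesis
    using assms by (simp add: matrix_mul_assoc[symmetric] matrix_minus_left cometric_right cometric_left)
qed

definition cov :: "'n \<Rightarrow> (real^'n \<Rightarrow> real^'n) \<Rightarrow> real^'n \<Rightarrow> real^'n" where
  "cov i Y x = partial i Y x + conn i x *v Y x"

lemma cov_smooth: "smooth_on U Y \<Longrightarrow> smooth_on U (cov i Y)"
  unfolding cov_def by (intro smooth_rules open_domain conn_smooth)

lemma nabla_eq_cov:
  assumes "Y differentiable at x"
  shows "nabla G X Y x = (\<Sum>i\<in>UNIV. X x $ i *\<^sub>R cov i Y x)"
  unfolding nabla_def frechet_derivative_eq_sum_partial[OF assms] cov_def
  by (simp add: vec_eq_iff matrix_vector_nth conn_def sum.distrib algebra_simps sum_distrib_left)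

text \<open>The Leibniz rule, for a field expanded in other fields with variable coefficients.\<close>

lemma cov_sum_scaleR:
  assumes "\<And>j. f j differentiable at x" "\<And>j. Y j differentiable at x"
  shows "cov i (\<lambda>y. \<Sum>j\<in>UNIV. f j y *\<^sub>R Y j y) x
    = (\<Sum>j\<in>(UNIV::'n set). partial i (f j) x *\<^sub>R Y j x + f j x *\<^sub>R cov i (Y j) x)"
proof -
  have "(\<lambda>y. f j y *\<^sub>R Y j y) differentiable at x" for j
    using bounded_bilinear.FDERIV[OF bounded_bilinear_scaleR] assms
    unfolding differentiable_def by blast
  then show ?thesis
    by (simp add: cov_def partial_sum partial_bilinear[OF bounded_bilinear_scaleR] assms
        linear_sum[OF matrix_vector_mul_linear] matrix_vector_mult_scaleR sum.distrib scaleR_right_distrib)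
qed

section \<open>Curvature\<close>

text \<open>The matrix of the curvature endomorphism R(\<partial>_i, \<partial>_j), i.e. the curvature of the connection
  matrices as for a connection on any vector bundle.\<close>

definition curv :: "'n \<Rightarrow> 'n \<Rightarrow> real^'n \<Rightarrow> real^'n^'n" where
  "curv i j x = partial i (conn j) x - partial j (conn i) x
     + conn i x ** conn j x - conn j x ** conn i x"

lemma curv_smooth: "smooth_on U (curv i j)"
  unfolding curv_def by (intro smooth_rules open_domain conn_smooth)

lemma curv_antisym: "curv i j x = - curv j i x"
  by (simp add: curv_def)

text \<open>The Ricci identity; the coordinate fields commute, so no bracket term appears.\<close>

lemma cov_commute:
  assumes "smooth_on U Y" "x \<in> U"
  shows "cov i (cov j Y) x - cov j (cov i Y) x = curv i j x *v Y x"
proof -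
  have "partial i (\<lambda>y. partial j Y y + conn j y *v Y y) x
      = partial i (partial j Y) x + (conn j x *v partial i Y x + partial i (conn j) x *v Y x)" for i j
  proof -
    have "(\<lambda>y. conn j y *v Y y) differentiable at x"
      by (intro diff_at smooth_rules open_domain conn_smooth assms)
    then show ?thesis
      using assms by (simp add: partial_add diff_at smooth_on_partial
          partial_bilinear[OF bounded_bilinear_matrix_vector] conn_smooth)
  qed
  then have "cov i (cov j Y) x = partial i (partial j Y) x + (conn j x *v partial i Y x + partial i (conn j) x *v Y x)
      + conn i x *v (partial j Y x + conn j x *v Y x)" for i j
    by (simp add: cov_def[abs_def])
  then show ?thesis
    using mixed_partials_commute[OF open_domain assms(2,1), of i j]
    by (simp add: curv_def algebra_simps matrix_vector_mul_assoc)
qed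

lemma curvature_eq:
  assumes "x \<in> U"
  shows "curvature G (\<lambda>_. u) (\<lambda>_. v) (\<lambda>_. w) x
     = (\<Sum>i\<in>UNIV. \<Sum>j\<in>UNIV. (u $ i * v $ j) *\<^sub>R (curv i j x *v w))"
proof -
  have n1: "nabla G (\<lambda>_. v) (\<lambda>_. w) = (\<lambda>y. \<Sum>j\<in>UNIV. v $ j *\<^sub>R cov j (\<lambda>_. w) y)" for v
    by (rule ext) (simp add: nabla_eq_cov)
  have sm: "smooth_on U (cov j (\<lambda>_. w))" for j
    by (intro cov_smooth smooth_on_const)
  have n2: "nabla G (\<lambda>_. u) (nabla G (\<lambda>_. v) (\<lambda>_. w)) x
    = (\<Sum>i\<in>UNIV. \<Sum>j\<in>UNIV. (u $ i * v $ j) *\<^sub>R cov i (cov j (\<lambda>_. w)) x)" for u v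
  proof -
    have "(\<lambda>y. \<Sum>j\<in>UNIV. v $ j *\<^sub>R cov j (\<lambda>_. w) y) differentiable at x"
      by (intro diff_at smooth_rules open_domain sm assms)
    moreover have "cov i (\<lambda>y. \<Sum>j\<in>UNIV. v $ j *\<^sub>R cov j (\<lambda>_. w) y) x
        = (\<Sum>j\<in>UNIV. v $ j *\<^sub>R cov i (cov j (\<lambda>_. w)) x)" for i
      using cov_sum_scaleR[of "\<lambda>j _. v $ j" x "\<lambda>j. cov j (\<lambda>_. w)" i] diff_at[OF sm assms]
      by simp
    ultimately show ?thesis
      unfolding n1 by (simp add: nabla_eq_cov scaleR_sum_right)
  qed
  have "lie_bracket (\<lambda>_. u) (\<lambda>_. v) = (\<lambda>_. 0)"
    by (rule ext) (simp add: lie_bracket_def)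
  then have n3: "nabla G (lie_bracket (\<lambda>_. u) (\<lambda>_. v)) (\<lambda>_. w) x = 0"
    by (simp add: nabla_eq_cov)
  have "nabla G (\<lambda>_. v) (nabla G (\<lambda>_. u) (\<lambda>_. w)) x
    = (\<Sum>i\<in>UNIV. \<Sum>j\<in>UNIV. (u $ i * v $ j) *\<^sub>R cov j (cov i (\<lambda>_. w)) x)"
    unfolding n2 by (subst sum.swap) (simp add: mult.commute)
  then show ?thesis
    unfolding curvature_def n2 n3
    by (simp add: sum_subtractf[symmetric] scaleR_diff_right[symmetric]
        cov_commute[OF smooth_on_const assms, symmetric])
qed

text \<open>Torsion-freeness makes both the derivative of \<Gamma>_j and the product \<Gamma>_i \<Gamma>_j symmetric under exchanging
  j with the column index k, so the twelve terms cancel in pairs.\<close>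

lemma first_bianchi:
  assumes "x \<in> U"
  shows "curv i j x $ a $ k + curv j k x $ a $ i + curv k i x $ a $ j = 0"
proof -
  have p: "partial i (conn j) x $ a $ k = partial i (conn k) x $ a $ j" for i j k
  proof -
    have "partial i (\<lambda>y. conn j y $ a $ k) x = partial i (\<lambda>y. conn k y $ a $ j) x"
      using torsion_free by (intro partial_cong[OF open_domain assms])
    then show ?thesis
      by (simp add: partial_nth assms diff_at conn_smooth smooth_on_nth open_domain)
  qed
  have q: "(conn i x ** conn j x) $ a $ k = (conn i x ** conn k x) $ a $ j" for i j k
    using torsion_free[OF assms] by (simp add: matrix_mult_nth)
  show ?thesis
    using p[of i j k] p[of j k i] p[of k i j] q[of i j k] q[of j k i] q[of k i j]
    by (simp add: curv_def)
qed

text \<open>The second derivatives of G commute. Expressing them through the connection by metric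
  compatibility leaves exactly this combination.\<close>

lemma curv_skew:
  assumes "x \<in> U"
  shows "transpose (curv i j x) ** G x + G x ** curv i j x = 0"
proof -
  note d = diff_at[OF _ assms]
  have second: "partial i (partial j G) x
      = (transpose (conn j x) ** (transpose (conn i x) ** G x + G x ** conn i x)
        + transpose (partial i (conn j) x) ** G x)
      + (G x ** partial i (conn j) x + (transpose (conn i x) ** G x + G x ** conn i x) ** conn j x)" for i j
  proof -
    have "partial i (partial j G) x
        = partial i (\<lambda>y. transpose (conn j y) ** G y + G y ** conn j y) x"
      using metric_compatible by (intro partial_cong[OF open_domain assms])
    also have "\<dots> = partial i (\<lambda>y. transpose (conn j y) ** G y) x + partial i (\<lambda>y. G y ** conn j y) x"
      by (intro partial_add d smooth_rules open_domain conn_smooth smooth_metric)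
    also have "partial i (\<lambda>y. transpose (conn j y) ** G y) x
        = transpose (conn j x) ** partial i G x + partial i (\<lambda>y. transpose (conn j y)) x ** G x"
      by (intro partial_bilinear[OF bounded_bilinear_matrix_mult] d smooth_rules open_domain conn_smooth smooth_metric)
    also have "partial i (\<lambda>y. G y ** conn j y) x = G x ** partial i (conn j) x + partial i G x ** conn j x"
      by (intro partial_bilinear[OF bounded_bilinear_matrix_mult] d smooth_rules open_domain conn_smooth smooth_metric)
    also have "partial i (\<lambda>y. transpose (conn j y)) x = transpose (partial i (conn j) x)"
      by (intro partial_bounded_linear[OF bounded_linear_transpose] d conn_smooth)
    finally show ?thesis by (simp only: metric_compatible[OF assms])
  qed
  have "partial i (partial j G) x = partial j (partial i G) x"
    by (rule mixed_partials_commute[OF open_domain assms smooth_metric])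
  then show ?thesis
    unfolding second curv_def
    by (simp add: transpose_add transpose_diff matrix_transpose_mul matrix_distribs matrix_mul_assoc algebra_simps)
qed

text \<open>The Jacobi identity for the operators \<partial>_i + \<Gamma>_i.\<close>

lemma second_bianchi:
  assumes "x \<in> U"
  shows "(partial m (curv i j) x + conn m x ** curv i j x - curv i j x ** conn m x)
    + (partial i (curv j m) x + conn i x ** curv j m x - curv j m x ** conn i x)
    + (partial j (curv m i) x + conn j x ** curv m i x - curv m i x ** conn j x) = 0"
proof -
  note d = diff_at[OF _ assms]
  have p: "partial m (curv i j) x = partial m (partial i (conn j)) x - partial m (partial j (conn i)) x
     + (conn i x ** partial m (conn j) x + partial m (conn i) x ** conn j x)
     - (conn j x ** partial m (conn i) x + partial m (conn j) x ** conn i x)" for m i j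
  proof -
    have s1: "smooth_on U (\<lambda>x. partial i (conn j) x - partial j (conn i) x)"
     and s2: "smooth_on U (\<lambda>x. partial i (conn j) x - partial j (conn i) x + conn i x ** conn j x)"
     and s3: "smooth_on U (\<lambda>x. conn i x ** conn j x)" for i j
      by (intro smooth_rules open_domain conn_smooth)+
    show ?thesis
      unfolding curv_def[abs_def]
      by (simp add: partial_add partial_diff d s1 s2 s3 conn_smooth smooth_on_partial
          partial_bilinear[OF bounded_bilinear_matrix_mult])
  qed
  have c: "partial a (partial b (conn k)) x = partial b (partial a (conn k)) x" for a b k
    by (rule mixed_partials_commute[OF open_domain assms conn_smooth])
  show ?thesis
    unfolding p c[of m i] c[of m j] c[of j i]
    by (simp add: curv_def matrix_distribs matrix_mul_assoc algebra_simps)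
qed

section \<open>Ricci and scalar curvature\<close>

definition ric :: "real^'n \<Rightarrow> real^'n^'n" where
  "ric x = (\<chi> j k. \<Sum>i\<in>UNIV. curv i j x $ i $ k)"

text \<open>The Ricci tensor with its second index raised; its transpose is the Ricci operator.\<close>

definition mixed_ric :: "real^'n \<Rightarrow> real^'n^'n" where
  "mixed_ric x = ric x ** cometric x"

lemma ric_smooth: "smooth_on U ric"
  unfolding ric_def[abs_def] by (intro smooth_rules open_domain curv_smooth)

lemma mixed_ric_smooth: "smooth_on U mixed_ric"
  unfolding mixed_ric_def[abs_def] by (intro smooth_rules open_domain ric_smooth cometric_smooth)

lemma ricci_eq:
  assumes "x \<in> U"
  shows "ricci G x v w = v \<bullet> (ric x *v w)"
proof -
  have "(\<Sum>i\<in>UNIV. \<Sum>j\<in>UNIV. (axis a 1 $ i * v $ j) *\<^sub>R (curv i j x *v w))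
      = (\<Sum>i\<in>UNIV. if i = a then \<Sum>j\<in>UNIV. v $ j *\<^sub>R (curv a j x *v w) else 0)" for a
    by (intro sum.cong) (simp_all add: axis_def)
  then have "ricci G x v w = (\<Sum>a\<in>UNIV. \<Sum>j\<in>UNIV. v $ j * (curv a j x *v w) $ a)"
    unfolding ricci_def trace_def matrix_def curvature_eq[OF assms] by simp
  also have "\<dots> = (\<Sum>j\<in>UNIV. v $ j * (\<Sum>a\<in>UNIV. (curv a j x *v w) $ a))"
    by (subst sum.swap) (simp add: sum_distrib_left)
  finally have "ricci G x v w = (\<Sum>j\<in>UNIV. v $ j * (\<Sum>a\<in>UNIV. (curv a j x *v w) $ a))" .
  moreover have "(\<Sum>a\<in>UNIV. (curv a j x *v w) $ a) = (ric x *v w) $ j" for j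
    unfolding matrix_vector_nth ric_def by (subst sum.swap) (simp add: sum_distrib_right)
  ultimately show ?thesis by (simp add: inner_vec_def)
qed

lemma trace_curv: "x \<in> U \<Longrightarrow> trace (curv i j x) = 0"
  using trace_metric_symmetrization[of x "curv i j x"] by (simp add: curv_skew trace_def)

text \<open>By the first Bianchi identity the antisymmetric part of the Ricci tensor is the trace of a
  curvature endomorphism, and these are skew.\<close>

lemma ric_commute:
  assumes "x \<in> U"
  shows "ric x $ j $ k = ric x $ k $ j"
proof -
  have "curv i j x $ i $ k - curv i k x $ i $ j = - curv j k x $ i $ i" for i
    using first_bianchi[OF assms, of i j i k] curv_antisym[of k i x] by simp
  then have "ric x $ j $ k - ric x $ k $ j = (\<Sum>i\<in>UNIV. - curv j k x $ i $ i)"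
    unfolding ric_def by (simp add: sum_subtractf[symmetric])
  then show ?thesis using trace_curv[OF assms, of j k] by (simp add: trace_def sum_negf)
qed

lemma ric_symmetric: "x \<in> U \<Longrightarrow> transpose (ric x) = ric x"
  by (simp add: vec_eq_iff transpose_nth ric_commute)

lemma ricci_operator_eq:
  assumes "x \<in> U"
  shows "ricci_operator G x v = cometric x *v (ric x *v v)"
  unfolding ricci_operator_def metric_inner_eq ricci_eq[OF assms]
proof (rule the_equality)
  show *: "\<forall>w. (cometric x *v (ric x *v v)) \<bullet> (G x *v w) = v \<bullet> (ric x *v w)"
  proof
    fix w
    have "(cometric x *v (ric x *v v)) \<bullet> (G x *v w) = w \<bullet> (G x *v (cometric x *v (ric x *v v)))"
      by (rule metric_commute[OF assms])
    also have "\<dots> = w \<bullet> (ric x *v v)"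
      by (simp add: matrix_vector_mul_assoc matrix_mul_assoc cometric_right assms)
    also have "\<dots> = v \<bullet> (ric x *v w)"
      by (metis dot_lmul_matrix inner_commute ric_symmetric[OF assms] transpose_matrix_vector)
    finally show "(cometric x *v (ric x *v v)) \<bullet> (G x *v w) = v \<bullet> (ric x *v w)" .
  qed
  fix q assume q: "\<forall>w. q \<bullet> (G x *v w) = v \<bullet> (ric x *v w)"
  define d where "d = q - cometric x *v (ric x *v v)"
  have "d \<bullet> (G x *v d) = 0"
    unfolding d_def inner_diff_left by (simp only: *[rule_format] q[rule_format] diff_self)
  then show "q = cometric x *v (ric x *v v)"
    using positive_metric[OF assms, of d] by (auto simp: d_def)
qed

lemma scalar_curvature_eq:
  assumes "x \<in> U"
  shows "scalar_curvature G x = trace (mixed_ric x)"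
proof -
  have "ricci_operator G x = (\<lambda>v. (cometric x ** ric x) *v v)"
    by (rule ext) (simp add: ricci_operator_eq[OF assms] matrix_vector_mul_assoc)
  then show ?thesis
    by (simp add: scalar_curvature_def mixed_ric_def trace_mul_sym[of "ric x" "cometric x"])
qed

lemma scalar_curvature_smooth: "smooth_on U (scalar_curvature G)"
proof -
  have "smooth_on U (\<lambda>x. trace (mixed_ric x))"
    by (intro smooth_rules open_domain mixed_ric_smooth)
  then show ?thesis
    using smooth_on_cong[OF open_domain, of "scalar_curvature G" "\<lambda>x. trace (mixed_ric x)"]
      scalar_curvature_eq by blast
qed

section \<open>The contracted second Bianchi identity\<close>

text \<open>Raising the column index of the curvature endomorphism by the inverse metric turns its
  skewness with respect to G into plain skewness of a matrix, and both traces of this tensor against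
  its lower indices become entries of the mixed Ricci tensor.\<close>

definition bicurv :: "'n \<Rightarrow> 'n \<Rightarrow> real^'n \<Rightarrow> real^'n^'n" where
  "bicurv i j x = curv i j x ** cometric x"

lemma bicurv_smooth: "smooth_on U (bicurv i j)"
  unfolding bicurv_def[abs_def] by (intro smooth_rules open_domain curv_smooth cometric_smooth)

lemma bicurv_antisym: "bicurv i j x = - bicurv j i x"
  by (metis bicurv_def curv_antisym matrix_minus_left)

lemma bicurv_skew:
  assumes "x \<in> U"
  shows "bicurv i j x $ a $ b = - bicurv i j x $ b $ a"
proof -
  have "cometric x ** (transpose (curv i j x) ** G x + G x ** curv i j x) ** cometric x
      = cometric x ** transpose (curv i j x) ** (G x ** cometric x) + (cometric x ** G x) ** curv i j x ** cometric x"
    by (simp only: matrix_distribs matrix_mul_assoc)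
  then have "cometric x ** transpose (curv i j x) + curv i j x ** cometric x = 0"
    using assms by (simp add: curv_skew cometric_left cometric_right)
  then have "transpose (bicurv i j x) + bicurv i j x = 0"
    by (simp add: bicurv_def matrix_transpose_mul cometric_symmetric assms)
  then have "(transpose (bicurv i j x) + bicurv i j x) $ b $ a = 0" by simp
  then show ?thesis by (simp add: transpose_nth)
qed

lemma bicurv_contract_first: "(\<Sum>i\<in>UNIV. bicurv i j x $ i $ l) = mixed_ric x $ j $ l"
  unfolding bicurv_def mixed_ric_def ric_def matrix_mult_nth
  by (subst sum.swap) (simp add: sum_distrib_right)

lemma bicurv_contract_second:
  assumes "x \<in> U"
  shows "(\<Sum>j\<in>UNIV. bicurv i j x $ l $ j) = mixed_ric x $ i $ l"
proof -
  have "bicurv i j x $ l $ j = bicurv j i x $ j $ l" for j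
    using bicurv_skew[OF assms, of j i l j] bicurv_antisym[of i j x] by simp
  then show ?thesis by (simp add: bicurv_contract_first)
qed

text \<open>The covariant derivative acts here on the two matrix indices only. The terms for the lower
  indices i and j are left out, because they cancel in the cyclic sum for a torsion-free connection.\<close>

definition nabla_bicurv :: "'n \<Rightarrow> 'n \<Rightarrow> 'n \<Rightarrow> real^'n \<Rightarrow> real^'n^'n" where
  "nabla_bicurv m i j x = partial m (bicurv i j) x + conn m x ** bicurv i j x
     + bicurv i j x ** transpose (conn m x)"

lemma nabla_bicurv_eq:
  assumes "x \<in> U"
  shows "nabla_bicurv m i j x
    = (partial m (curv i j) x + conn m x ** curv i j x - curv i j x ** conn m x) ** cometric x"
proof -
  have "partial m (bicurv i j) x = curv i j x ** partial m cometric x + partial m (curv i j) x ** cometric x"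
    unfolding bicurv_def[abs_def]
    by (intro partial_bilinear[OF bounded_bilinear_matrix_mult] diff_at[OF _ assms] curv_smooth cometric_smooth)
  then show ?thesis
    unfolding nabla_bicurv_def partial_inverse_metric[OF assms]
    by (simp add: bicurv_def matrix_distribs matrix_mul_assoc)
qed

lemma second_bianchi_bicurv:
  assumes "x \<in> U"
  shows "nabla_bicurv m i j x + nabla_bicurv i j m x + nabla_bicurv j m i x = 0"
  using second_bianchi[OF assms, of m i j]
  by (simp add: nabla_bicurv_eq[OF assms] matrix_add_rdistrib[symmetric])

text \<open>Take the trace of the second Bianchi identity over both pairs of indices. The first of the three
  cyclic terms becomes the derivative of the scalar curvature. The other two agree after renaming
  indices, by the two antisymmetries of the curvature, and become the divergence of the Ricci tensor;
  in invariant terms dR = 2 div Ric.\<close>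

lemma contracted_bianchi:
  assumes "x \<in> U"
  shows "partial m (scalar_curvature G) x
    = 2 * (\<Sum>i\<in>UNIV. partial i mixed_ric x $ m $ i)
      + 2 * (\<Sum>i\<in>UNIV. \<Sum>l\<in>UNIV. conn i x $ i $ l * mixed_ric x $ m $ l)
      - 2 * (\<Sum>j\<in>UNIV. \<Sum>l\<in>UNIV. conn m x $ j $ l * mixed_ric x $ j $ l)"
proof -
  note d = diff_at[OF _ assms]
  let ?N = "\<lambda>m i j. nabla_bicurv m i j x"
  have partial_nth': "partial k (\<lambda>y. bicurv i j y $ a $ b) x = partial k (bicurv i j) x $ a $ b" for k i j a b
    by (simp add: partial_nth d bicurv_smooth smooth_on_nth open_domain)
  have partial_contract: "(\<Sum>j\<in>UNIV. partial k (bicurv j i) x $ j $ l) = partial k mixed_ric x $ i $ l" for k i l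
  proof -
    have "partial k (\<lambda>y. \<Sum>j\<in>UNIV. bicurv j i y $ j $ l) x = partial k (\<lambda>y. mixed_ric y $ i $ l) x"
      by (simp add: bicurv_contract_first)
    then show ?thesis
      by (simp add: partial_sum partial_nth' d bicurv_smooth mixed_ric_smooth smooth_on_nth open_domain partial_nth)
  qed
  have partial_skew: "partial k (bicurv i j) x $ a $ b = - partial k (bicurv i j) x $ b $ a" for k i j a b
  proof -
    have "partial k (\<lambda>y. bicurv i j y $ a $ b) x = partial k (\<lambda>y. - bicurv i j y $ b $ a) x"
      using bicurv_skew by (intro partial_cong[OF open_domain assms])
    also have "\<dots> = - partial k (\<lambda>y. bicurv i j y $ b $ a) x"
      by (intro partial_bounded_linear[OF bounded_linear_minus[OF bounded_linear_ident]] d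
          smooth_on_nth open_domain bicurv_smooth)
    finally show ?thesis by (simp add: partial_nth')
  qed
  have partial_antisym: "partial k (bicurv i j) x = - partial k (bicurv j i) x" for k i j
  proof -
    have "bicurv i j = (\<lambda>y. - bicurv j i y)" using bicurv_antisym by blast
    then show ?thesis
      using partial_bounded_linear[OF bounded_linear_minus[OF bounded_linear_ident] d[OF bicurv_smooth]]
      by simp
  qed
  have N_antisym: "?N k i j = - ?N k j i" for k i j
    unfolding nabla_bicurv_def partial_antisym[of k i j] bicurv_antisym[of i j]
    by (simp add: matrix_minus_left matrix_minus_right)
  have N_skew: "?N k i j $ a $ b = - ?N k i j $ b $ a" for k i j a b
  proof -
    have "conn k x $ a $ c * bicurv i j x $ c $ b = - (bicurv i j x $ b $ c * conn k x $ a $ c)" for a b c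
      using bicurv_skew[OF assms, of i j c b] by simp
    then have "(conn k x ** bicurv i j x) $ a $ b = - (bicurv i j x ** transpose (conn k x)) $ b $ a" for a b
      by (simp add: matrix_mult_nth transpose_nth sum_negf)
    from this[of a b] this[of b a] partial_skew[of k i j a b] show ?thesis
      by (simp add: nabla_bicurv_def)
  qed
  have first: "(\<Sum>i\<in>UNIV. \<Sum>j\<in>UNIV. ?N m i j $ i $ j)
      = partial m (scalar_curvature G) x + 2 * (\<Sum>j\<in>UNIV. \<Sum>l\<in>UNIV. conn m x $ j $ l * mixed_ric x $ j $ l)"
  proof -
    have "partial m (scalar_curvature G) x = partial m (\<lambda>y. trace (mixed_ric y)) x"
      using scalar_curvature_eq by (intro partial_cong[OF open_domain assms])
    also have "\<dots> = trace (partial m mixed_ric x)"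
      by (intro partial_bounded_linear[OF bounded_linear_trace] d mixed_ric_smooth)
    also have "\<dots> = (\<Sum>j\<in>UNIV. \<Sum>i\<in>UNIV. partial m (bicurv i j) x $ i $ j)"
      by (simp add: trace_def partial_contract)
    finally have s: "(\<Sum>i\<in>UNIV. \<Sum>j\<in>UNIV. partial m (bicurv i j) x $ i $ j) = partial m (scalar_curvature G) x"
      by (subst sum.swap) simp
    have a: "(\<Sum>i\<in>UNIV. \<Sum>j\<in>UNIV. (conn m x ** bicurv i j x) $ i $ j)
        = (\<Sum>i\<in>UNIV. \<Sum>l\<in>UNIV. conn m x $ i $ l * mixed_ric x $ i $ l)"
    proof (rule sum.cong[OF refl])
      fix i
      have "(\<Sum>j\<in>UNIV. (conn m x ** bicurv i j x) $ i $ j)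
        = (\<Sum>l\<in>UNIV. \<Sum>j\<in>UNIV. conn m x $ i $ l * bicurv i j x $ l $ j)"
        unfolding matrix_mult_nth by (rule sum.swap)
      then show "(\<Sum>j\<in>UNIV. (conn m x ** bicurv i j x) $ i $ j)
        = (\<Sum>l\<in>UNIV. conn m x $ i $ l * mixed_ric x $ i $ l)"
        by (simp add: sum_distrib_left[symmetric] bicurv_contract_second[OF assms])
    qed
    have b: "(\<Sum>i\<in>UNIV. \<Sum>j\<in>UNIV. (bicurv i j x ** transpose (conn m x)) $ i $ j)
        = (\<Sum>j\<in>UNIV. \<Sum>l\<in>UNIV. conn m x $ j $ l * mixed_ric x $ j $ l)"
    proof -
      have "(\<Sum>i\<in>UNIV. \<Sum>j\<in>UNIV. (bicurv i j x ** transpose (conn m x)) $ i $ j)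
        = (\<Sum>j\<in>UNIV. \<Sum>i\<in>UNIV. \<Sum>l\<in>UNIV. bicurv i j x $ i $ l * conn m x $ j $ l)"
        unfolding matrix_mult_nth transpose_nth by (rule sum.swap)
      also have "\<dots> = (\<Sum>j\<in>UNIV. \<Sum>l\<in>UNIV. \<Sum>i\<in>UNIV. bicurv i j x $ i $ l * conn m x $ j $ l)"
        by (rule sum.cong[OF refl], rule sum.swap)
      finally show ?thesis
        unfolding sum_distrib_right[symmetric] bicurv_contract_first by (simp only: mult.commute)
    qed
    show ?thesis
      unfolding nabla_bicurv_def using s a b by (simp add: sum.distrib)
  qed
  have second: "(\<Sum>i\<in>UNIV. \<Sum>j\<in>UNIV. ?N i j m $ i $ j)
     = - (\<Sum>i\<in>UNIV. partial i mixed_ric x $ m $ i)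
       - (\<Sum>i\<in>UNIV. \<Sum>l\<in>UNIV. conn i x $ i $ l * mixed_ric x $ m $ l)"
  proof -
    have c: "(\<Sum>j\<in>UNIV. bicurv j m x $ l $ j) = - mixed_ric x $ m $ l" for l
      using bicurv_contract_second[OF assms, of m l] bicurv_antisym[of m _ x] by (simp add: sum_negf)
    have "partial i (bicurv j m) x $ i $ j = - partial i (bicurv j m) x $ j $ i" for i j
      by (rule partial_skew)
    then have s: "(\<Sum>j\<in>UNIV. partial i (bicurv j m) x $ i $ j) = - partial i mixed_ric x $ m $ i" for i
      by (simp add: sum_negf partial_contract)
    have a: "(\<Sum>j\<in>UNIV. (conn i x ** bicurv j m x) $ i $ j)
        = - (\<Sum>l\<in>UNIV. conn i x $ i $ l * mixed_ric x $ m $ l)" for i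
      unfolding matrix_mult_nth
      by (subst sum.swap) (simp add: sum_distrib_left[symmetric] c sum_negf)
    \<comment> \<open>A factor skew in i and l meets a Christoffel symbol symmetric in i and l.\<close>
    have b: "(\<Sum>i\<in>UNIV. \<Sum>j\<in>UNIV. (bicurv j m x ** transpose (conn i x)) $ i $ j) = 0"
    proof -
      have z: "(\<Sum>i\<in>UNIV. \<Sum>l\<in>UNIV. bicurv j m x $ i $ l * conn i x $ j $ l) = 0" for j
      proof -
        let ?s = "\<Sum>i\<in>UNIV. \<Sum>l\<in>UNIV. bicurv j m x $ i $ l * conn i x $ j $ l"
        have "?s = (\<Sum>i\<in>UNIV. \<Sum>l\<in>UNIV. bicurv j m x $ l $ i * conn l x $ j $ i)"
          by (rule sum.swap)
        also have "\<dots> = (\<Sum>i\<in>UNIV. \<Sum>l\<in>UNIV. - (bicurv j m x $ i $ l * conn i x $ j $ l))"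
        proof (intro sum.cong refl)
          fix i l
          show "bicurv j m x $ l $ i * conn l x $ j $ i = - (bicurv j m x $ i $ l * conn i x $ j $ l)"
            using bicurv_skew[OF assms, of j m l i] torsion_free[OF assms, of l j i] by simp
        qed
        finally show ?thesis by (simp add: sum_negf)
      qed
      have "(\<Sum>i\<in>UNIV. \<Sum>j\<in>UNIV. (bicurv j m x ** transpose (conn i x)) $ i $ j)
        = (\<Sum>j\<in>UNIV. \<Sum>i\<in>UNIV. \<Sum>l\<in>UNIV. bicurv j m x $ i $ l * conn i x $ j $ l)"
        unfolding matrix_mult_nth transpose_nth by (rule sum.swap)
      then show ?thesis using z by simp
    qed
    show ?thesis
      unfolding nabla_bicurv_def using s a b by (simp add: sum.distrib sum_negf sum_subtractf)
  qed
  have "?N j m i $ i $ j = ?N j i m $ j $ i" for i j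
    using N_antisym[of j m i] N_skew[of j i m i j] by simp
  then have third: "(\<Sum>i\<in>UNIV. \<Sum>j\<in>UNIV. ?N j m i $ i $ j) = (\<Sum>i\<in>UNIV. \<Sum>j\<in>UNIV. ?N i j m $ i $ j)"
    by (subst sum.swap) simp
  have "(\<Sum>i\<in>UNIV. \<Sum>j\<in>UNIV. (?N m i j + ?N i j m + ?N j m i) $ i $ j) = 0"
    by (simp add: second_bianchi_bicurv[OF assms])
  then have "(\<Sum>i\<in>UNIV. \<Sum>j\<in>UNIV. ?N m i j $ i $ j) + 2 * (\<Sum>i\<in>UNIV. \<Sum>j\<in>UNIV. ?N i j m $ i $ j) = 0"
    using third by (simp add: sum.distrib)
  then show ?thesis unfolding first second by (simp add: algebra_simps)
qed

text \<open>The endomorphism v \<mapsto> \<nabla>_v X; its trace is the divergence of X.\<close>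

definition cov_matrix :: "(real^'n \<Rightarrow> real^'n) \<Rightarrow> real^'n \<Rightarrow> real^'n^'n" where
  "cov_matrix X x = (\<chi> k i. cov i X x $ k)"

lemma cov_matrix_smooth: "smooth_on U X \<Longrightarrow> smooth_on U (cov_matrix X)"
  unfolding cov_matrix_def[abs_def] by (intro smooth_rules open_domain cov_smooth)

text \<open>Torsion-freeness exchanges the direction of differentiation with the differentiated index.\<close>

lemma conn_vector: "x \<in> U \<Longrightarrow> (conn i x *v v) $ k = (\<Sum>m\<in>UNIV. v $ m * conn m x $ k $ i)"
  by (simp add: matrix_vector_nth torsion_free[of x i] mult.commute)

text \<open>By the Leibniz rule, the divergence of the vector field Q X is (div Ric)(X) plus the pairing of
  the Ricci tensor with the covariant derivative of X. Substituting this into dR = 2 div Ric leaves only Q X to be differentiated, which is useful when X is an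
  eigenvector field of the Ricci operator.\<close>

lemma contracted_bianchi_along_field:
  assumes X: "smooth_on U X" and x: "x \<in> U"
  shows "(\<Sum>m\<in>UNIV. X x $ m * partial m (scalar_curvature G) x)
    = 2 * trace (cov_matrix (\<lambda>y. ricci_operator G y (X y)) x)
      - 2 * trace (cov_matrix X x ** transpose (mixed_ric x))"
proof -
  note d = diff_at[OF _ x]
  define Z where "Z y = transpose (mixed_ric y) *v X y" for y
  have Z_eq: "ricci_operator G y (X y) = Z y" if "y \<in> U" for y
    using that by (simp add: ricci_operator_eq Z_def mixed_ric_def matrix_transpose_mul
        cometric_symmetric ric_symmetric matrix_vector_mul_assoc del: transpose_matrix_vector)
  have Z_nth: "Z y $ i = (\<Sum>m\<in>UNIV. X y $ m * mixed_ric y $ m $ i)" for y i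
    by (simp add: Z_def matrix_vector_nth transpose_nth mult.commute del: transpose_matrix_vector)
  have "cov_matrix (\<lambda>y. ricci_operator G y (X y)) x = cov_matrix Z x"
    using partial_cong[OF open_domain x Z_eq] by (simp add: cov_matrix_def cov_def Z_eq[OF x])
  then have "trace (cov_matrix (\<lambda>y. ricci_operator G y (X y)) x)
      = (\<Sum>i\<in>UNIV. partial i Z x $ i) + (\<Sum>i\<in>UNIV. \<Sum>l\<in>UNIV. conn i x $ i $ l * Z x $ l)"
    by (simp add: trace_def cov_matrix_def cov_def sum.distrib matrix_vector_nth)
  moreover have "partial i Z x $ i = (\<Sum>m\<in>UNIV. X x $ m * partial i mixed_ric x $ m $ i)
      + (\<Sum>m\<in>UNIV. partial i X x $ m * mixed_ric x $ m $ i)" for i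
  proof -
    have "partial i Z x = transpose (mixed_ric x) *v partial i X x + partial i (\<lambda>y. transpose (mixed_ric y)) x *v X x"
      unfolding Z_def[abs_def]
      by (intro partial_bilinear[OF bounded_bilinear_matrix_vector] d smooth_rules open_domain mixed_ric_smooth X)
    also have "partial i (\<lambda>y. transpose (mixed_ric y)) x = transpose (partial i mixed_ric x)"
      by (intro partial_bounded_linear[OF bounded_linear_transpose] d mixed_ric_smooth)
    finally show ?thesis
      by (simp add: matrix_vector_nth transpose_nth mult.commute del: transpose_matrix_vector)
  qed
  moreover have "trace (cov_matrix X x ** transpose (mixed_ric x))
      = (\<Sum>i\<in>UNIV. \<Sum>m\<in>UNIV. partial i X x $ m * mixed_ric x $ m $ i)
        + (\<Sum>m\<in>UNIV. X x $ m * (\<Sum>j\<in>UNIV. \<Sum>l\<in>UNIV. conn m x $ j $ l * mixed_ric x $ j $ l))"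
  proof -
    have "trace (cov_matrix X x ** transpose (mixed_ric x))
      = (\<Sum>j\<in>UNIV. \<Sum>l\<in>UNIV. partial l X x $ j * mixed_ric x $ j $ l)
       + (\<Sum>j\<in>UNIV. \<Sum>l\<in>UNIV. \<Sum>m\<in>UNIV. X x $ m * conn m x $ j $ l * mixed_ric x $ j $ l)"
      unfolding trace_mult_transpose cov_matrix_def cov_def
      by (simp add: conn_vector[OF x] distrib_right sum.distrib sum_distrib_right)
    also have "(\<Sum>j\<in>UNIV. \<Sum>l\<in>UNIV. partial l X x $ j * mixed_ric x $ j $ l)
        = (\<Sum>i\<in>UNIV. \<Sum>m\<in>UNIV. partial i X x $ m * mixed_ric x $ m $ i)"
      by (rule sum.swap)
    also have "(\<Sum>j\<in>UNIV. \<Sum>l\<in>UNIV. \<Sum>m\<in>UNIV. X x $ m * conn m x $ j $ l * mixed_ric x $ j $ l)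
        = (\<Sum>j\<in>UNIV. \<Sum>m\<in>UNIV. \<Sum>l\<in>UNIV. X x $ m * conn m x $ j $ l * mixed_ric x $ j $ l)"
      by (rule sum.cong[OF refl], rule sum.swap)
    also have "\<dots> = (\<Sum>m\<in>UNIV. X x $ m * (\<Sum>j\<in>UNIV. \<Sum>l\<in>UNIV. conn m x $ j $ l * mixed_ric x $ j $ l))"
      by (subst sum.swap) (simp add: sum_distrib_left mult.assoc)
    finally show ?thesis .
  qed
  moreover have "(\<Sum>i\<in>UNIV. \<Sum>l\<in>UNIV. conn i x $ i $ l * Z x $ l)
      = (\<Sum>m\<in>UNIV. X x $ m * (\<Sum>i\<in>UNIV. \<Sum>l\<in>UNIV. conn i x $ i $ l * mixed_ric x $ m $ l))"
  proof -
    have "(\<Sum>i\<in>UNIV. \<Sum>l\<in>UNIV. conn i x $ i $ l * Z x $ l)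
      = (\<Sum>i\<in>UNIV. \<Sum>l\<in>UNIV. \<Sum>m\<in>UNIV. X x $ m * (conn i x $ i $ l * mixed_ric x $ m $ l))"
      by (simp add: Z_nth sum_distrib_left ac_simps)
    also have "\<dots> = (\<Sum>i\<in>UNIV. \<Sum>m\<in>UNIV. \<Sum>l\<in>UNIV. X x $ m * (conn i x $ i $ l * mixed_ric x $ m $ l))"
      by (rule sum.cong[OF refl], rule sum.swap)
    also have "\<dots> = (\<Sum>m\<in>UNIV. \<Sum>i\<in>UNIV. \<Sum>l\<in>UNIV. X x $ m * (conn i x $ i $ l * mixed_ric x $ m $ l))"
      by (rule sum.swap)
    finally show ?thesis by (simp add: sum_distrib_left)
  qed
  moreover have "(\<Sum>i\<in>UNIV. \<Sum>m\<in>UNIV. X x $ m * partial i mixed_ric x $ m $ i)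
      = (\<Sum>m\<in>UNIV. X x $ m * (\<Sum>i\<in>UNIV. partial i mixed_ric x $ m $ i))"
    by (subst sum.swap) (simp add: sum_distrib_left)
  ultimately show ?thesis
    unfolding contracted_bianchi[OF x]
    by (simp add: sum.distrib sum_subtractf algebra_simps sum_distrib_left[symmetric])
qed

section \<open>The Laplacian of a vector field\<close>

text \<open>The covariant derivative of the endomorphism field \<nabla>X in the i-th coordinate direction; its j-th
  column is the second covariant derivative of X in the directions i and j.\<close>

definition second_cov :: "(real^'n \<Rightarrow> real^'n) \<Rightarrow> 'n \<Rightarrow> real^'n \<Rightarrow> real^'n^'n" where
  "second_cov X i x = partial i (cov_matrix X) x + conn i x ** cov_matrix X x - cov_matrix X x ** conn i x"

lemma second_cov_nth:
  assumes "smooth_on U X" "x \<in> U"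
  shows "second_cov X i x $ a $ j = cov i (cov j X) x $ a - (\<Sum>k\<in>UNIV. conn i x $ k $ j * cov k X x $ a)"
proof -
  have s: "smooth_on U (\<lambda>y. cov_matrix X y $ a)"
    by (intro smooth_rules open_domain cov_matrix_smooth assms)
  have "partial i (cov_matrix X) x $ a $ j = partial i (\<lambda>y. cov_matrix X y $ a $ j) x"
    by (simp add: partial_nth diff_at[OF cov_matrix_smooth[OF assms(1)] assms(2)] diff_at[OF s assms(2)])
  also have "\<dots> = partial i (cov j X) x $ a"
    by (simp add: cov_matrix_def partial_nth diff_at[OF cov_smooth[OF assms(1)] assms(2)])
  finally show ?thesis
    by (simp add: second_cov_def matrix_mult_nth cov_def[of i "cov j X"] matrix_vector_nth)
      (simp add: cov_matrix_def mult.commute)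
qed

text \<open>The Ricci identity again: the correction terms with Christoffel symbols are symmetric in i and j.\<close>

lemma second_cov_commute:
  assumes "smooth_on U X" "x \<in> U"
  shows "second_cov X i x $ a $ j - second_cov X j x $ a $ i = (curv i j x *v X x) $ a"
proof -
  have "(\<Sum>k\<in>UNIV. conn i x $ k $ j * cov k X x $ a) = (\<Sum>k\<in>UNIV. conn j x $ k $ i * cov k X x $ a)"
    by (simp add: torsion_free[OF assms(2), of i _ j])
  then show ?thesis
    by (simp add: second_cov_nth assms cov_commute[symmetric])
qed

text \<open>Contracting the Ricci identity produces the Ricci tensor as the difference between the two ways of
  differentiating X twice and tracing, namely the divergence of \<nabla>X and the gradient of the divergence of X.\<close>

lemma trace_second_cov_commute:
  assumes "smooth_on U X" "x \<in> U"
  shows "(\<Sum>i\<in>UNIV. second_cov X i x $ i $ c) = trace (second_cov X c x) + (ric x *v X x) $ c"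
proof -
  have "(\<Sum>i\<in>UNIV. (curv i c x *v X x) $ i) = (ric x *v X x) $ c"
    unfolding matrix_vector_nth ric_def by (subst sum.swap) (simp add: sum_distrib_right)
  moreover have "(\<Sum>i\<in>UNIV. (curv i c x *v X x) $ i)
      = (\<Sum>i\<in>UNIV. second_cov X i x $ i $ c) - trace (second_cov X c x)"
    unfolding second_cov_commute[OF assms, symmetric] trace_def by (rule sum_subtractf)
  ultimately show ?thesis by simp
qed

text \<open>The derivatives of the frame cancel between the two terms of the Laplacian, and the products of
  its components sum up to the inverse metric. Hence whichever frame is chosen, the result is the trace
  of the second covariant derivative.\<close>

lemma vector_laplacian_eq:
  assumes X: "smooth_on U X" and x: "x \<in> U"
  shows "vector_laplacian G X x = (\<chi> a. \<Sum>i\<in>UNIV. \<Sum>j\<in>UNIV. cometric x $ i $ j * second_cov X i x $ a $ j)"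
proof -
  define e where "e = (SOME e. \<exists>W. open W \<and> x \<in> W \<and> orthonormal_frame_on G W e)"
  have "\<exists>e W. open W \<and> x \<in> W \<and> orthonormal_frame_on G W e"
    using exists_orthonormal_frame open_domain x by blast
  from someI_ex[OF this] obtain W where W: "open W" "x \<in> W" and frame: "orthonormal_frame_on G W e"
    unfolding e_def by blast
  let ?V = "W \<inter> U"
  have V: "open ?V" "x \<in> ?V" using W open_domain x by auto
  have e_diff: "e a differentiable at x" for a
    using frame W smooth_on_differentiable unfolding orthonormal_frame_on_def by blast
  have e_nth_diff: "(\<lambda>y. e a y $ j) differentiable at x" for a j
    using bounded_linear.has_derivative[OF bounded_linear_vec_nth[of j]] e_diff[of a]
    unfolding differentiable_def by blast
  have C_diff: "cov j X differentiable at x" for j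
    by (intro diff_at cov_smooth X x)
  have summand: "nabla G (e a) (nabla G (e a) X) x - nabla G (nabla G (e a) (e a)) X x
     = (\<Sum>i\<in>UNIV. \<Sum>j\<in>UNIV. (e a x $ i * e a x $ j) *\<^sub>R
         (cov i (cov j X) x - (\<Sum>k\<in>UNIV. conn i x $ k $ j *\<^sub>R cov k X x)))" for a
  proof -
    define F where "F y = (\<Sum>j\<in>UNIV. e a y $ j *\<^sub>R cov j X y)" for y
    have NF: "nabla G (e a) X y = F y" if "y \<in> U" for y
      using that by (simp add: F_def nabla_eq_cov diff_at[OF X])
    have "(\<lambda>y. e a y $ j *\<^sub>R cov j X y) differentiable at x" for j
      using bounded_bilinear.FDERIV[OF bounded_bilinear_scaleR] e_nth_diff C_diff
      unfolding differentiable_def by blast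
    then have "F differentiable at x"
      unfolding F_def by (intro differentiable_sum) auto
    then have "nabla G (e a) X differentiable at x"
      using differentiable_cong[OF open_domain x, of "nabla G (e a) X" F] NF by blast
    then have "nabla G (e a) (nabla G (e a) X) x = (\<Sum>i\<in>UNIV. e a x $ i *\<^sub>R cov i F x)"
      using partial_cong[OF open_domain x, of "nabla G (e a) X" F, OF NF] by (simp add: nabla_eq_cov cov_def NF[OF x])
    also have "\<dots> = (\<Sum>i\<in>UNIV. \<Sum>j\<in>UNIV. (e a x $ i * partial i (e a) x $ j) *\<^sub>R cov j X x)
        + (\<Sum>i\<in>UNIV. \<Sum>j\<in>UNIV. (e a x $ i * e a x $ j) *\<^sub>R cov i (cov j X) x)"
      unfolding F_def
      by (simp add: cov_sum_scaleR e_nth_diff C_diff partial_nth e_diff scaleR_sum_right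
          scaleR_right_distrib sum.distrib)
    finally have first: "nabla G (e a) (nabla G (e a) X) x = \<dots>" .
    have n: "nabla G (e a) (e a) x $ k = (\<Sum>i\<in>UNIV. e a x $ i * partial i (e a) x $ k)
        + (\<Sum>i\<in>UNIV. \<Sum>j\<in>UNIV. e a x $ i * e a x $ j * conn i x $ k $ j)" for k
      by (simp add: nabla_eq_cov e_diff cov_def distrib_left sum.distrib matrix_vector_nth
          sum_distrib_left ac_simps)
    have "nabla G (nabla G (e a) (e a)) X x
       = (\<Sum>k\<in>UNIV. \<Sum>i\<in>UNIV. (e a x $ i * partial i (e a) x $ k) *\<^sub>R cov k X x)
       + (\<Sum>k\<in>UNIV. \<Sum>i\<in>UNIV. \<Sum>j\<in>UNIV. (e a x $ i * e a x $ j * conn i x $ k $ j) *\<^sub>R cov k X x)"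
      by (simp add: nabla_eq_cov diff_at[OF X x] n scaleR_left_distrib sum.distrib scaleR_sum_left)
    also have "(\<Sum>k\<in>UNIV. \<Sum>i\<in>UNIV. (e a x $ i * partial i (e a) x $ k) *\<^sub>R cov k X x)
       = (\<Sum>i\<in>UNIV. \<Sum>j\<in>UNIV. (e a x $ i * partial i (e a) x $ j) *\<^sub>R cov j X x)"
      by (rule sum.swap)
    also have "(\<Sum>k\<in>UNIV. \<Sum>i\<in>UNIV. \<Sum>j\<in>UNIV. (e a x $ i * e a x $ j * conn i x $ k $ j) *\<^sub>R cov k X x)
      = (\<Sum>i\<in>UNIV. \<Sum>k\<in>UNIV. \<Sum>j\<in>UNIV. (e a x $ i * e a x $ j * conn i x $ k $ j) *\<^sub>R cov k X x)"
      by (rule sum.swap)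
    also have "\<dots> = (\<Sum>i\<in>UNIV. \<Sum>j\<in>UNIV. \<Sum>k\<in>UNIV. (e a x $ i * e a x $ j * conn i x $ k $ j) *\<^sub>R cov k X x)"
      by (rule sum.cong[OF refl], rule sum.swap)
    finally show ?thesis
      unfolding first
      by (simp add: scaleR_diff_right sum_subtractf scaleR_sum_right)
  qed
  have "vector_laplacian G X x = (\<Sum>a\<in>UNIV. \<Sum>i\<in>UNIV. \<Sum>j\<in>UNIV. (e a x $ i * e a x $ j) *\<^sub>R
         (cov i (cov j X) x - (\<Sum>k\<in>UNIV. conn i x $ k $ j *\<^sub>R cov k X x)))"
    unfolding vector_laplacian_def e_def[symmetric] frame_laplacian_def summand ..
  also have "\<dots> = (\<Sum>i\<in>UNIV. \<Sum>a\<in>UNIV. \<Sum>j\<in>UNIV. (e a x $ i * e a x $ j) *\<^sub>R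
         (cov i (cov j X) x - (\<Sum>k\<in>UNIV. conn i x $ k $ j *\<^sub>R cov k X x)))"
    by (rule sum.swap)
  also have "\<dots> = (\<Sum>i\<in>UNIV. \<Sum>j\<in>UNIV. \<Sum>a\<in>UNIV. (e a x $ i * e a x $ j) *\<^sub>R
         (cov i (cov j X) x - (\<Sum>k\<in>UNIV. conn i x $ k $ j *\<^sub>R cov k X x)))"
    by (rule sum.cong[OF refl], rule sum.swap)
  also have "\<dots> = (\<Sum>i\<in>UNIV. \<Sum>j\<in>UNIV. cometric x $ i $ j *\<^sub>R
         (cov i (cov j X) x - (\<Sum>k\<in>UNIV. conn i x $ k $ j *\<^sub>R cov k X x)))"
    by (simp add: inverse_metric_eq_frame[OF frame W(2) x] scaleR_sum_left)
  finally show ?thesis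
    by (simp add: vec_eq_iff second_cov_nth[OF X x])
qed

section \<open>Conformal vector fields\<close>

text \<open>For the Levi-Civita connection the Lie derivative of the metric is the symmetrization of \<nabla>X with
  respect to the metric.\<close>

lemma lie_derivative_eq:
  assumes X: "smooth_on U X" and x: "x \<in> U"
  shows "lie_derivative_metric X G x (axis a 1) (axis b 1)
    = (transpose (cov_matrix X x) ** G x + G x ** cov_matrix X x) $ a $ b"
proof -
  have X_diff: "X differentiable at x" by (rule diff_at[OF X x])
  have lb: "lie_bracket X (\<lambda>_. axis c 1) x = - partial c X x" for c
    by (simp add: lie_bracket_def partial_def)
  have "(\<lambda>y. G y $ a $ b) differentiable at x"
    by (intro diff_at smooth_rules open_domain smooth_metric x)
  then have "frechet_derivative (\<lambda>y. metric_inner G y (axis a 1) (axis b 1)) (at x) (X x)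
      = (\<Sum>m\<in>UNIV. X x $ m * partial m G x $ a $ b)"
    unfolding metric_inner_eq inner_axis_matrix_axis
    by (simp add: frechet_derivative_eq_sum_partial partial_metric_nth x)
  also have "\<dots> = (\<Sum>m\<in>UNIV. X x $ m * (G x ** conn m x) $ b $ a) + (\<Sum>m\<in>UNIV. X x $ m * (G x ** conn m x) $ a $ b)"
  proof -
    have "partial m G x $ a $ b = (G x ** conn m x) $ b $ a + (G x ** conn m x) $ a $ b" for m
      by (simp add: metric_compatible x transpose_mult_metric transpose_nth)
    then show ?thesis by (simp add: distrib_left sum.distrib)
  qed
  finally have 1: "frechet_derivative (\<lambda>y. metric_inner G y (axis a 1) (axis b 1)) (at x) (X x) = \<dots>" .
  have 2: "(G x ** cov_matrix X x) $ c $ d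
      = axis c 1 \<bullet> (G x *v partial d X x) + (\<Sum>m\<in>UNIV. X x $ m * (G x ** conn m x) $ c $ d)" for c d
  proof -
    have "(\<Sum>k\<in>UNIV. G x $ c $ k * (conn d x *v X x) $ k)
        = (\<Sum>m\<in>UNIV. X x $ m * (G x ** conn m x) $ c $ d)"
      unfolding conn_vector[OF x] matrix_mult_nth sum_distrib_left
      by (subst sum.swap) (simp add: ac_simps)
    then show ?thesis
      by (simp add: matrix_mult_nth cov_matrix_def cov_def distrib_left sum.distrib inner_axis' matrix_vector_nth[of _ "partial d X x"])
  qed
  have 3: "(transpose (cov_matrix X x) ** G x) $ a $ b = (G x ** cov_matrix X x) $ b $ a"
    by (simp add: transpose_mult_metric x transpose_nth)
  have "lie_derivative_metric X G x (axis a 1) (axis b 1)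
    = frechet_derivative (\<lambda>y. metric_inner G y (axis a 1) (axis b 1)) (at x) (X x)
      + axis b 1 \<bullet> (G x *v partial a X x) + axis a 1 \<bullet> (G x *v partial b X x)"
    unfolding lie_derivative_metric_def lb metric_inner_eq
    using metric_commute[OF x, of "- partial a X x" "axis b 1"]
    by (simp add: linear_neg[OF matrix_vector_mul_linear])
  then show ?thesis unfolding 1 by (simp add: 2 3)
qed

definition conformal_field :: "(real^'n \<Rightarrow> real^'n) \<Rightarrow> (real^'n \<Rightarrow> real) \<Rightarrow> bool" where
  "conformal_field X \<rho> \<longleftrightarrow> smooth_on U X \<and> smooth_on U \<rho> \<and>
    (\<forall>y\<in>U. transpose (cov_matrix X y) ** G y + G y ** cov_matrix X y = (2 * \<rho> y) *\<^sub>R G y)"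

text \<open>Covariant differentiation of the conformal equation, in which G is parallel.\<close>

lemma conformal_second_cov:
  assumes conf: "conformal_field X \<rho>" and x: "x \<in> U"
  shows "transpose (second_cov X i x) ** G x + G x ** second_cov X i x = (2 * partial i \<rho> x) *\<^sub>R G x"
proof -
  have X: "smooth_on U X" and \<rho>: "smooth_on U \<rho>"
    and eq: "\<And>y. y \<in> U \<Longrightarrow> transpose (cov_matrix X y) ** G y + G y ** cov_matrix X y = (2 * \<rho> y) *\<^sub>R G y"
    using conf by (auto simp: conformal_field_def)
  note A = cov_matrix_smooth[OF X] and d = diff_at[OF _ x]
  have "partial i (\<lambda>y. transpose (cov_matrix X y) ** G y + G y ** cov_matrix X y) x
      = (transpose (cov_matrix X x) ** partial i G x + transpose (partial i (cov_matrix X) x) ** G x)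
        + (G x ** partial i (cov_matrix X) x + partial i G x ** cov_matrix X x)"
  proof -
    have "partial i (\<lambda>y. transpose (cov_matrix X y) ** G y + G y ** cov_matrix X y) x
      = partial i (\<lambda>y. transpose (cov_matrix X y) ** G y) x + partial i (\<lambda>y. G y ** cov_matrix X y) x"
      by (intro partial_add d smooth_rules open_domain smooth_metric A)
    also have "partial i (\<lambda>y. transpose (cov_matrix X y) ** G y) x
      = transpose (cov_matrix X x) ** partial i G x + partial i (\<lambda>y. transpose (cov_matrix X y)) x ** G x"
      by (intro partial_bilinear[OF bounded_bilinear_matrix_mult] d smooth_rules open_domain smooth_metric A)
    also have "partial i (\<lambda>y. transpose (cov_matrix X y)) x = transpose (partial i (cov_matrix X) x)"
      by (intro partial_bounded_linear[OF bounded_linear_transpose] d A)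
    also have "partial i (\<lambda>y. G y ** cov_matrix X y) x
      = G x ** partial i (cov_matrix X) x + partial i G x ** cov_matrix X x"
      by (intro partial_bilinear[OF bounded_bilinear_matrix_mult] d smooth_metric A)
    finally show ?thesis .
  qed
  moreover have "partial i (\<lambda>y. transpose (cov_matrix X y) ** G y + G y ** cov_matrix X y) x
      = partial i (\<lambda>y. \<rho> y *\<^sub>R (2 *\<^sub>R G y)) x"
    by (intro partial_cong[OF open_domain x]) (simp add: eq mult.commute)
  moreover have "partial i (\<lambda>y. \<rho> y *\<^sub>R (2 *\<^sub>R G y)) x = \<rho> x *\<^sub>R (2 *\<^sub>R partial i G x) + partial i \<rho> x *\<^sub>R (2 *\<^sub>R G x)"
  proof -
    have "partial i (\<lambda>y. \<rho> y *\<^sub>R (2 *\<^sub>R G y)) x = \<rho> x *\<^sub>R partial i (\<lambda>y. 2 *\<^sub>R G y) x + partial i \<rho> x *\<^sub>R (2 *\<^sub>R G x)"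
      by (intro partial_bilinear[OF bounded_bilinear_scaleR] d smooth_rules open_domain smooth_metric \<rho>)
    also have "partial i (\<lambda>y. 2 *\<^sub>R G y) x = 2 *\<^sub>R partial i G x"
      by (intro partial_bounded_linear[OF bounded_linear_scaleR_right] d smooth_metric)
    finally show ?thesis .
  qed
  ultimately have 1: "(transpose (cov_matrix X x) ** partial i G x + transpose (partial i (cov_matrix X) x) ** G x)
        + (G x ** partial i (cov_matrix X) x + partial i G x ** cov_matrix X x)
      = (2 * \<rho> x) *\<^sub>R partial i G x + (2 * partial i \<rho> x) *\<^sub>R G x"
    by (simp add: mult.commute)
  \<comment> \<open>The connection terms of the covariant derivative reproduce the derivative of G.\<close>
  have 2: "transpose (conn i x) ** (transpose (cov_matrix X x) ** G x + G x ** cov_matrix X x)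
      + (transpose (cov_matrix X x) ** G x + G x ** cov_matrix X x) ** conn i x
      = (2 * \<rho> x) *\<^sub>R partial i G x"
    unfolding eq[OF x] metric_compatible[OF x]
    by (simp add: matrix_scalar_ac scalar_matrix_assoc scaleR_right_distrib)
  have "transpose (second_cov X i x) ** G x + G x ** second_cov X i x
     + (transpose (conn i x) ** (transpose (cov_matrix X x) ** G x + G x ** cov_matrix X x)
      + (transpose (cov_matrix X x) ** G x + G x ** cov_matrix X x) ** conn i x)
     = (transpose (cov_matrix X x) ** partial i G x + transpose (partial i (cov_matrix X) x) ** G x)
        + (G x ** partial i (cov_matrix X) x + partial i G x ** cov_matrix X x)"
    unfolding second_cov_def metric_compatible[OF x]
    by (simp add: transpose_add transpose_diff matrix_transpose_mul matrix_distribs matrix_mul_assoc algebra_simps)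
  then show ?thesis unfolding 1 2 by simp
qed

text \<open>In invariant form, \<Delta>X + Q X = (2 - n) grad \<rho> for every conformal field X with factor \<rho>, here with the
  index lowered. The differentiated conformal equation exchanges the roles of two indices in the second
  derivative of X. Its trace over those indices gives n d\<rho> for the divergence, while the trace that
  defines the Laplacian gives 2 d\<rho> minus the divergence term with the derivatives in the opposite order;
  reordering them costs the Ricci tensor.\<close>

lemma conformal_laplacian:
  assumes conf: "conformal_field X \<rho>" and x: "x \<in> U"
  shows "(G x *v vector_laplacian G X x) $ c + (ric x *v X x) $ c = (2 - real CARD('n)) * partial c \<rho> x"
proof -
  have X: "smooth_on U X" using conf by (simp add: conformal_field_def)
  have B: "G x ** second_cov X i x ** cometric x = (2 * partial i \<rho> x) *\<^sub>R mat 1 - transpose (second_cov X i x)" for i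
  proof -
    have "(transpose (second_cov X i x) ** G x + G x ** second_cov X i x) ** cometric x = ((2 * partial i \<rho> x) *\<^sub>R G x) ** cometric x"
      unfolding conformal_second_cov[OF conf x] ..
    then have "transpose (second_cov X i x) ** (G x ** cometric x) + G x ** second_cov X i x ** cometric x
        = (2 * partial i \<rho> x) *\<^sub>R (G x ** cometric x)"
      by (simp only: matrix_distribs matrix_mul_assoc scalar_matrix_assoc)
    then show ?thesis using x by (simp add: cometric_right algebra_simps)
  qed
  have "trace (cometric x ** (transpose (second_cov X c x) ** G x + G x ** second_cov X c x)) = 2 * trace (second_cov X c x)"
    by (rule trace_metric_symmetrization[OF x])
  moreover have "trace (cometric x ** ((2 * partial c \<rho> x) *\<^sub>R G x)) = 2 * partial c \<rho> x * real CARD('n)"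
    using x by (simp add: matrix_scalar_ac scalar_matrix_assoc[symmetric] cometric_left trace_scaleR trace_I)
  ultimately have tr: "trace (second_cov X c x) = real CARD('n) * partial c \<rho> x"
    unfolding conformal_second_cov[OF conf x] by (simp add: mult.commute)
  have "(G x *v vector_laplacian G X x) $ c = (\<Sum>i\<in>UNIV. (G x ** second_cov X i x ** cometric x) $ c $ i)"
  proof -
    have "(G x *v vector_laplacian G X x) $ c
      = (\<Sum>a\<in>UNIV. \<Sum>i\<in>UNIV. \<Sum>j\<in>UNIV. G x $ c $ a * second_cov X i x $ a $ j * cometric x $ j $ i)"
      by (simp add: vector_laplacian_eq[OF X x] matrix_vector_nth sum_distrib_left cometric_nth_commute[OF x] ac_simps)
    also have "\<dots> = (\<Sum>i\<in>UNIV. \<Sum>a\<in>UNIV. \<Sum>j\<in>UNIV. G x $ c $ a * second_cov X i x $ a $ j * cometric x $ j $ i)"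
      by (rule sum.swap)
    also have "\<dots> = (\<Sum>i\<in>UNIV. \<Sum>j\<in>UNIV. \<Sum>a\<in>UNIV. G x $ c $ a * second_cov X i x $ a $ j * cometric x $ j $ i)"
      by (rule sum.cong[OF refl], rule sum.swap)
    finally show ?thesis by (simp add: matrix_mult_nth sum_distrib_right)
  qed
  also have "\<dots> = (\<Sum>i\<in>UNIV. (if i = c then 2 * partial i \<rho> x else 0) - second_cov X i x $ i $ c)"
    unfolding B by (intro sum.cong refl) (simp add: mat_def transpose_nth)
  also have "\<dots> = 2 * partial c \<rho> x - (real CARD('n) * partial c \<rho> x + (ric x *v X x) $ c)"
    by (simp add: sum_subtractf trace_second_cov_commute[OF X x] tr)
  finally show ?thesis by (simp add: algebra_simps)
qed

text \<open>The covariant derivative of a gradient is a Hessian.\<close>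

lemma gradient_cov_symmetric:
  assumes X: "smooth_on U X" and f: "smooth_on U f" and x: "x \<in> U"
    and grad: "\<And>y c. y \<in> U \<Longrightarrow> (G y *v X y) $ c = partial c f y"
  shows "transpose (cov_matrix X x) ** G x = G x ** cov_matrix X x"
proof -
  note d = diff_at[OF _ x]
  have eq: "(G x ** cov_matrix X x) $ c $ i = partial i (partial c f) x - (\<Sum>k\<in>UNIV. conn i x $ k $ c * (G x *v X x) $ k)" for c i
  proof -
    have "partial i (partial c f) x = partial i (\<lambda>y. (G y *v X y) $ c) x"
      using grad by (intro partial_cong[OF open_domain x]) simp
    also have "\<dots> = partial i (\<lambda>y. G y *v X y) x $ c"
      by (intro partial_nth d smooth_rules open_domain smooth_metric X)
    also have "partial i (\<lambda>y. G y *v X y) x = G x *v partial i X x + partial i G x *v X x"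
      by (intro partial_bilinear[OF bounded_bilinear_matrix_vector] d smooth_metric X)
    also have "\<dots> = transpose (conn i x) *v (G x *v X x) + G x *v cov i X x"
      unfolding metric_compatible[OF x] cov_def
      by (simp add: matrix_vector_right_distrib matrix_vector_mult_add_rdistrib matrix_vector_mul_assoc
          del: transpose_matrix_vector)
    finally show ?thesis
      by (simp add: matrix_vector_nth[of "transpose (conn i x)"] transpose_nth matrix_mult_nth cov_matrix_def
          matrix_vector_nth[of "G x" "cov i X x"] del: transpose_matrix_vector)
  qed
  have "(G x ** cov_matrix X x) $ c $ i = (G x ** cov_matrix X x) $ i $ c" for c i
    unfolding eq mixed_partials_commute[OF open_domain x f, of i c]
    by (simp add: torsion_free[OF x, of i _ c])
  then show ?thesis by (simp add: transpose_mult_metric x vec_eq_iff transpose_nth)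
qed

text \<open>The conformal equation fixes the symmetric part of \<nabla>X, and for a gradient there is no other part.\<close>

lemma conformal_gradient_cov:
  assumes conf: "conformal_field X \<rho>" and f: "smooth_on U f" and x: "x \<in> U"
    and grad: "\<And>y c. y \<in> U \<Longrightarrow> (G y *v X y) $ c = partial c f y"
  shows "cov_matrix X x = \<rho> x *\<^sub>R mat 1"
proof -
  have "transpose (cov_matrix X x) ** G x + G x ** cov_matrix X x = (2 * \<rho> x) *\<^sub>R G x"
    using conf x by (simp add: conformal_field_def)
  moreover have "transpose (cov_matrix X x) ** G x = G x ** cov_matrix X x"
    using conf by (intro gradient_cov_symmetric[OF _ f x grad]) (simp_all add: conformal_field_def)
  ultimately have "(1/2) *\<^sub>R (2 *\<^sub>R (G x ** cov_matrix X x)) = (1/2) *\<^sub>R ((2 * \<rho> x) *\<^sub>R G x)"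
    by (simp only: scaleR_2)
  then have "cometric x ** (G x ** cov_matrix X x) = cometric x ** (\<rho> x *\<^sub>R G x)" by simp
  then show ?thesis
    using x by (simp add: matrix_mul_assoc cometric_left matrix_scalar_ac scalar_matrix_assoc[symmetric])
qed

text \<open>If \<nabla>X is \<rho> times the identity, the second covariant derivative of X is d\<rho> times the identity, and
  the contracted Ricci identity reads off Ric(X) from it.\<close>

lemma conformal_gradient_ric:
  assumes conf: "conformal_field X \<rho>" and f: "smooth_on U f" and x: "x \<in> U"
    and grad: "\<And>y c. y \<in> U \<Longrightarrow> (G y *v X y) $ c = partial c f y"
  shows "(ric x *v X x) $ c = (1 - real CARD('n)) * partial c \<rho> x"
proof -
  have X: "smooth_on U X" and \<rho>: "smooth_on U \<rho>" using conf by (auto simp: conformal_field_def)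
  have A: "cov_matrix X y = \<rho> y *\<^sub>R mat 1" if "y \<in> U" for y
    using conformal_gradient_cov[OF conf f that grad] by simp
  have "partial i (cov_matrix X) x = partial i \<rho> x *\<^sub>R mat 1" for i
  proof -
    have "partial i (cov_matrix X) x = partial i (\<lambda>y. \<rho> y *\<^sub>R mat 1) x"
      using A by (intro partial_cong[OF open_domain x])
    also have "\<dots> = partial i \<rho> x *\<^sub>R mat 1"
      by (intro partial_bounded_linear[OF bounded_linear_scaleR_left] diff_at[OF \<rho> x])
    finally show ?thesis .
  qed
  then have B: "second_cov X i x = partial i \<rho> x *\<^sub>R mat 1" for i
    by (simp add: second_cov_def A[OF x] matrix_scalar_ac scalar_matrix_assoc[symmetric])
  have "(\<Sum>i\<in>UNIV. second_cov X i x $ i $ c) = partial c \<rho> x"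
    by (simp add: B mat_def if_distrib cong: if_cong)
  moreover have "trace (second_cov X c x) = real CARD('n) * partial c \<rho> x"
    by (simp add: B trace_scaleR trace_I)
  ultimately show ?thesis
    using trace_second_cov_commute[OF X x, of c] by (simp add: algebra_simps)
qed

section \<open>Yamabe solitons in a chart\<close>

text \<open>The soliton equation makes X conformal with factor \<rho> = R - \<lambda>, and the equation for its Laplacian
  makes it a gradient: X = grad f with f = - \<rho> / \<kappa> and \<kappa> = \<mu> / (n - 2). So \<nabla>X = \<rho> and Q X = (n - 1) \<kappa> X, and the
  contracted Bianchi identity along X yields
  - \<kappa> g(X, X) = X(R) = 2 \<rho> (n (n - 1) \<kappa> - R).
  The two bounds on R say that both factors on the right are nonnegative. Hence X vanishes, and then so
  does \<nabla>X = \<rho>.\<close>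

lemma local_soliton_trivial:
  assumes X: "smooth_on U X" and n: "CARD('n) > 2" and \<mu>: "\<mu> > 0"
    and soliton: "\<And>y v w. y \<in> U \<Longrightarrow>
      1/2 * lie_derivative_metric X G y v w = (scalar_curvature G y - lam) * metric_inner G y v w"
    and lap: "\<And>y. y \<in> U \<Longrightarrow> ricci_operator G y (X y) + vector_laplacian G X y = \<mu> *\<^sub>R X y"
    and bounds: "\<And>y. y \<in> U \<Longrightarrow> lam \<le> scalar_curvature G y \<and>
      scalar_curvature G y \<le> real CARD('n) * (real CARD('n) - 1) / (real CARD('n) - 2) * \<mu>"
    and x: "x \<in> U"
  shows "scalar_curvature G x = lam"
proof -
  let ?n = "real CARD('n)"
  define \<rho> where "\<rho> y = scalar_curvature G y - lam" for y
  define \<kappa> where "\<kappa> = \<mu> / (?n - 2)"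
  have n2: "?n - 2 > 0" using n by simp
  have \<kappa>: "\<kappa> > 0" using n2 \<mu> by (simp add: \<kappa>_def)
  have \<rho>: "smooth_on U \<rho>"
    unfolding \<rho>_def[abs_def] by (intro smooth_on_diff open_domain scalar_curvature_smooth smooth_on_const)
  have conf: "conformal_field X \<rho>"
    unfolding conformal_field_def
  proof (intro conjI ballI X \<rho>)
    fix y assume y: "y \<in> U"
    have "(transpose (cov_matrix X y) ** G y + G y ** cov_matrix X y) $ a $ b = ((2 * \<rho> y) *\<^sub>R G y) $ a $ b" for a b
      using soliton[OF y, of "axis a 1" "axis b 1"]
      unfolding lie_derivative_eq[OF X y] metric_inner_eq inner_axis_matrix_axis by (simp add: \<rho>_def)
    then show "transpose (cov_matrix X y) ** G y + G y ** cov_matrix X y = (2 * \<rho> y) *\<^sub>R G y"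
      unfolding vec_eq_iff by blast
  qed
  have grad\<rho>: "partial c \<rho> y = - \<kappa> * (G y *v X y) $ c" if y: "y \<in> U" for y c
  proof -
    have "G y *v (ricci_operator G y (X y) + vector_laplacian G X y) = G y *v (\<mu> *\<^sub>R X y)"
      using lap[OF y] by simp
    then have "ric y *v X y + G y *v vector_laplacian G X y = \<mu> *\<^sub>R (G y *v X y)"
      using y by (simp add: matrix_vector_right_distrib matrix_vector_mult_scaleR ricci_operator_eq
          matrix_vector_mul_assoc matrix_mul_assoc cometric_right)
    then have "(ric y *v X y + G y *v vector_laplacian G X y) $ c = (\<mu> *\<^sub>R (G y *v X y)) $ c" by simp
    then have "(2 - ?n) * partial c \<rho> y = \<mu> * (G y *v X y) $ c"
      using conformal_laplacian[OF conf y, of c] by (simp add: add.commute)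
    then show ?thesis using n2 by (simp add: \<kappa>_def field_simps)
  qed
  define f where "f y = (- 1 / \<kappa>) * \<rho> y" for y
  have f: "smooth_on U f"
    unfolding f_def[abs_def] by (intro smooth_on_mult open_domain smooth_on_const \<rho>)
  have grad: "(G y *v X y) $ c = partial c f y" if y: "y \<in> U" for y c
  proof -
    have "partial c f y = (- 1 / \<kappa>) * partial c \<rho> y"
      unfolding f_def[abs_def]
      by (intro partial_bounded_linear[OF bounded_linear_mult_right] diff_at[OF \<rho> y])
    then show ?thesis using \<kappa> by (simp add: grad\<rho>[OF y])
  qed
  have A: "cov_matrix X y = \<rho> y *\<^sub>R mat 1" if "y \<in> U" for y
    using conformal_gradient_cov[OF conf f that grad] by simp
  define c where "c = (?n - 1) * \<kappa>"
  have Q: "ricci_operator G y (X y) = c *\<^sub>R X y" if y: "y \<in> U" for y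
  proof -
    have "(ric y *v X y) $ i = (c *\<^sub>R (G y *v X y)) $ i" for i
      using conformal_gradient_ric[OF conf f y grad, of i] grad\<rho>[OF y, of i] by (simp add: c_def algebra_simps)
    then have "ric y *v X y = c *\<^sub>R (G y *v X y)" unfolding vec_eq_iff by blast
    then show ?thesis
      using y by (simp add: ricci_operator_eq matrix_vector_mult_scaleR matrix_vector_mul_assoc cometric_left)
  qed
  have X0: "X y = 0" if y: "y \<in> U" for y
  proof -
    have "cov_matrix (\<lambda>z. ricci_operator G z (X z)) y = c *\<^sub>R cov_matrix X y"
    proof -
      have "partial i (\<lambda>z. ricci_operator G z (X z)) y = partial i (\<lambda>z. c *\<^sub>R X z) y" for i
        using Q by (intro partial_cong[OF open_domain y])
      also have "partial i (\<lambda>z. c *\<^sub>R X z) y = c *\<^sub>R partial i X y" for i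
        by (intro partial_bounded_linear[OF bounded_linear_scaleR_right] diff_at[OF X y])
      finally show ?thesis
        by (simp add: vec_eq_iff cov_matrix_def cov_def Q[OF y] matrix_vector_mult_scaleR algebra_simps)
    qed
    then have "trace (cov_matrix (\<lambda>z. ricci_operator G z (X z)) y) = c * ?n * \<rho> y"
      by (simp add: A[OF y] trace_scaleR trace_I)
    moreover have "trace (cov_matrix X y ** transpose (mixed_ric y)) = \<rho> y * scalar_curvature G y"
      by (simp add: A[OF y] scalar_matrix_assoc[symmetric] trace_scaleR trace_transpose scalar_curvature_eq[OF y])
    moreover have "partial m (scalar_curvature G) y = - \<kappa> * (G y *v X y) $ m" for m
      using grad\<rho>[OF y, of m] unfolding \<rho>_def[abs_def]
      by (simp add: partial_diff diff_at[OF scalar_curvature_smooth y])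
    ultimately have "(\<Sum>m\<in>UNIV. X y $ m * (- \<kappa> * (G y *v X y) $ m)) = 2 * (c * ?n * \<rho> y) - 2 * (\<rho> y * scalar_curvature G y)"
      using contracted_bianchi_along_field[OF X y] by simp
    moreover have "(\<Sum>m\<in>UNIV. X y $ m * (- \<kappa> * (G y *v X y) $ m)) = - \<kappa> * (X y \<bullet> (G y *v X y))"
      by (simp add: inner_vec_def sum_distrib_left ac_simps sum_negf)
    \<comment> \<open>The first factor is controlled by the lower bound on R, the second by the upper bound.\<close>
    moreover have "\<rho> y * (c * ?n - scalar_curvature G y) \<ge> 0"
      using bounds[OF y] by (intro mult_nonneg_nonneg) (simp_all add: \<rho>_def c_def \<kappa>_def field_simps)
    ultimately have "\<kappa> * (X y \<bullet> (G y *v X y)) \<le> 0" by (simp add: algebra_simps)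
    then have "X y \<bullet> (G y *v X y) \<le> 0" using \<kappa> by (simp add: mult_le_0_iff)
    then show ?thesis using positive_metric[OF y, of "X y"] by force
  qed
  have "partial i X x = 0" for i
    using partial_cong[OF open_domain x, of X "\<lambda>_. 0" i] X0 by simp
  then have "cov_matrix X x = 0"
    by (simp add: vec_eq_iff cov_matrix_def cov_def X0[OF x])
  moreover have "cov_matrix X x $ i $ i = \<rho> x" for i
    by (simp add: A[OF x] mat_def)
  ultimately show ?thesis by (simp add: \<rho>_def)
qed

end

theorem theorem3p1:
  fixes M :: "'a topology"
    and A :: "('a, 'n::finite) chart set"
    and g :: "('a, 'n) chart \<Rightarrow> real^'n \<Rightarrow> real^'n^'n"
    and \<xi> :: "('a, 'n) chart \<Rightarrow> real^'n \<Rightarrow> real^'n"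
    and lam \<mu> :: real
  assumes "yamabe_soliton M A g \<xi> lam"
    and "CARD('n) > 2"
    and "\<mu> > 0"
    and "\<And>c x. c \<in> A \<Longrightarrow> x \<in> chart_image c \<Longrightarrow>
      ricci_operator (g c) x (\<xi> c x) + vector_laplacian (g c) (\<xi> c) x = \<mu> *\<^sub>R \<xi> c x"
    and "\<And>c x. c \<in> A \<Longrightarrow> x \<in> chart_image c \<Longrightarrow>
      lam \<le> scalar_curvature (g c) x \<and>
      scalar_curvature (g c) x
        \<le> real CARD('n) * (real CARD('n) - 1) / (real CARD('n) - 2) * \<mu>"
  shows "yamabe_metric A g"
proof -
  interpret yamabe_soliton M A g \<xi> lam by fact
  have "scalar_curvature (g c) x = lam" if c: "c \<in> A" and x: "x \<in> chart_image c" for c x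
  proof -
    interpret local_metric "chart_image c" "g c"
    proof
      show "open (chart_image c)" "smooth_on (chart_image c) (g c)"
        using c chart_image_open metric_smooth by auto
      fix y assume y: "y \<in> chart_image c"
      have "g c y $ i $ j = g c y $ j $ i" for i j
        using metric_symmetric[OF c y, of "axis i 1" "axis j 1"]
        by (simp add: metric_inner_eq inner_axis_matrix_axis)
      then show "transpose (g c y) = g c y" by (simp add: vec_eq_iff transpose_nth)
      show "v \<bullet> (g c y *v v) > 0" if "v \<noteq> 0" for v
        using metric_positive[OF c y that] by (simp add: metric_inner_eq)
    qed
    have "smooth_on (chart_image c) (\<xi> c)"
      using soliton_field c by (simp add: smooth_vector_field_def)
    from local_soliton_trivial[OF this assms(2,3) soliton_equation[OF c] assms(4)[OF c] assms(5)[OF c] x]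
    show ?thesis .
  qed
  then show ?thesis by (auto simp: yamabe_metric_def)
qed

end
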